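(* Let $F$ be a non-archimedean local field over a non-dyadic place (so $2\in\mathfrak{o}^\times$), with valuation ring $\mathfrak{o}$, and let $H\cong End(V)$ be a split quaternion algebra over $F$ ($V$ a $2$-dimensional $F$-vector space) with an orthogonal involution $\ddagger$. Suppose $\mathcal{O}$ is a maximal $\ddagger$-order. Then there exist a fractional ideal $\mathfrak{a}\subset\mathfrak{o}$ and an $\mathfrak{a}$-maximal lattice $\Lambda\subset V$ such that $$\mathcal{O}=End(\Lambda)\cap End(\Lambda^\sharp).$$ Furthermore, all maximal $\ddagger$-orders are isomorphic (i.e. for any two maximal $\ddagger$-orders $\mathcal{O}_1,\mathcal{O}_2$ there is an automorphism $\phi$ of $(H,\ddagger)$ with $\phi(\mathcal{O}_1)=\mathcal{O}_2$), and $$disc(\mathcal{O})=disc(H)\cap\iota(disc(\ddagger)).$$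
   Context: Orthogonal involution: $F$-linear anti-automorphism of order $2$ with $3$-dimensional $+1$-eigenspace. An order is an $\mathfrak{o}$-lattice subring with $1$ spanning $H$; a $\ddagger$-order is an order with $\mathcal{O}^\ddagger=\mathcal{O}$; a maximal $\ddagger$-order is one not properly contained in another $\ddagger$-order; an automorphism of $(H,\ddagger)$ is an algebra automorphism commuting with $\ddagger$. $b_\ddagger$ is a nondegenerate symmetric bilinear form on $V$ (fixed up to scaling) with $b_\ddagger(v,\sigma w)=b_\ddagger(\sigma^\ddagger v,w)$, and $q_\ddagger(v)=b_\ddagger(v,v)$. A lattice is a finitely generated $\mathfrak{o}$-submodule spanning $V$; $\Lambda^\sharp=\{v: b_\ddagger(v,\Lambda)\subset\mathfrak{o}\}$; $End(\Lambda)=\{\sigma:\sigma\Lambda\subset\Lambda\}$. $\mathfrak{n}\Lambda$ is the fractional ideal generated by $q_\ddagger(\Lambda)$; $\Lambda$ is $\mathfrak{a}$-maximal if $\mathfrak{n}\Lambda\subset\mathfrak{a}$ and no lattice $\Lambda'\supsetneq\Lambda$ has $\mathfrak{n}\Lambda'\subset\mathfrak{a}$. $disc(\mathcal{O})$ is the reduced discriminant; $disc(H)=\mathfrak{o}$ for split $H$. $disc(\ddagger)=nrd(h)(F^\times)^2$ for nonzero $h$ with $h^\ddagger=-h$; $\iota([\lambda])$ is the ideal of $\mathfrak{o}$ generated by $[\lambda]\cap\mathfrak{o}$. *)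

theory Defs
  imports "HOL-Analysis.Analysis"
begin

section \<open>Non-archimedean local fields via a normalized discrete valuation\<close>

text \<open>The valuation v is only meaningful on nonzero elements; its value at 0 is irrelevant.\<close>

definition oring :: "('k::field \<Rightarrow> int) \<Rightarrow> 'k set" where
  "oring v = {x. x = 0 \<or> 0 \<le> v x}"

definition discrete_valuation :: "('k::field \<Rightarrow> int) \<Rightarrow> bool" where
  "discrete_valuation v \<longleftrightarrow>
     (\<forall>x y. x \<noteq> 0 \<longrightarrow> y \<noteq> 0 \<longrightarrow> v (x * y) = v x + v y) \<and>
     (\<forall>x y. x \<noteq> 0 \<longrightarrow> y \<noteq> 0 \<longrightarrow> x + y \<noteq> 0 \<longrightarrow> min (v x) (v y) \<le> v (x + y)) \<and>
     (\<exists>p. p \<noteq> 0 \<and> v p = 1)"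

text \<open>x is "v-close to 0 at level N": x = 0 or v x >= N.\<close>
definition vsmall :: "('k::field \<Rightarrow> int) \<Rightarrow> int \<Rightarrow> 'k \<Rightarrow> bool" where
  "vsmall v N x \<longleftrightarrow> x = 0 \<or> N \<le> v x"

definition nonarch_local_field :: "('k::field \<Rightarrow> int) \<Rightarrow> bool" where
  "nonarch_local_field v \<longleftrightarrow>
     discrete_valuation v \<and>
     \<comment> \<open>complete\<close>
     (\<forall>s :: nat \<Rightarrow> 'k. (\<forall>N. \<exists>M. \<forall>m\<ge>M. \<forall>n\<ge>M. vsmall v N (s m - s n)) \<longrightarrow>
        (\<exists>L. \<forall>N. \<exists>M. \<forall>n\<ge>M. vsmall v N (s n - L))) \<and>
     \<comment> \<open>finite residue field\<close>
     (\<exists>R. finite R \<and> R \<subseteq> oring v \<and> (\<forall>x\<in>oring v. \<exists>r\<in>R. vsmall v 1 (x - r)))"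

text \<open>Non-dyadic: 2 is a unit of the valuation ring.\<close>
definition nondyadic :: "('k::field \<Rightarrow> int) \<Rightarrow> bool" where
  "nondyadic v \<longleftrightarrow> (2::'k) \<noteq> 0 \<and> v 2 = 0"

section \<open>Modules over the valuation ring\<close>

definition o_span :: "('k::field \<Rightarrow> int) \<Rightarrow> ('k \<Rightarrow> 'b \<Rightarrow> 'b) \<Rightarrow> 'b::comm_monoid_add set \<Rightarrow> 'b set" where
  "o_span v sm S = {x. \<exists>A c. finite A \<and> A \<subseteq> S \<and> (\<forall>a\<in>A. c a \<in> oring v) \<and>
                          x = (\<Sum>a\<in>A. sm (c a) a)}"

text \<open>A lattice: a finitely generated o-submodule spanning the ambient F-vector space.\<close>
definition o_lattice :: "('k::field \<Rightarrow> int) \<Rightarrow> ('k \<Rightarrow> 'b \<Rightarrow> 'b) \<Rightarrow> 'b::ab_group_add set \<Rightarrow> bool" where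
  "o_lattice v sm L \<longleftrightarrow> (\<exists>A. finite A \<and> L = o_span v sm A) \<and> module.span sm L = UNIV"

text \<open>Fractional ideal of o: a nonzero finitely generated o-submodule of F.\<close>
definition frac_ideal :: "('k::field \<Rightarrow> int) \<Rightarrow> 'k set \<Rightarrow> bool" where
  "frac_ideal v I \<longleftrightarrow> (\<exists>A. finite A \<and> I = o_span v (*) A) \<and> I \<noteq> {0}"

section \<open>The split quaternion algebra H = End(V), V = F^2\<close>

type_synonym 'k quat = "'k^2^2"
type_synonym 'k vect = "'k^2"

definition hsmul :: "'k::field \<Rightarrow> 'k quat \<Rightarrow> 'k quat" where
  "hsmul c M = (\<chi> i j. c * M$i$j)"

definition orth_involution :: "('k::field quat \<Rightarrow> 'k quat) \<Rightarrow> bool" where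
  "orth_involution J \<longleftrightarrow>
     (\<forall>A B. J (A + B) = J A + J B) \<and> (\<forall>c A. J (hsmul c A) = hsmul c (J A)) \<and>
     (\<forall>A B. J (A ** B) = J B ** J A) \<and>
     (\<forall>A. J (J A) = A) \<and> (\<exists>A. J A \<noteq> A) \<and>
     vector_space.dim hsmul {A. J A = A} = 3"

text \<open>b_J: nondegenerate symmetric bilinear form on V adjoint to J.\<close>
definition adjoint_form :: "('k::field quat \<Rightarrow> 'k quat) \<Rightarrow> ('k vect \<Rightarrow> 'k vect \<Rightarrow> 'k) \<Rightarrow> bool" where
  "adjoint_form J b \<longleftrightarrow>
     (\<forall>x y z. b (x + y) z = b x z + b y z) \<and> (\<forall>c x y. b (c *s x) y = c * b x y) \<and>
     (\<forall>x y. b x y = b y x) \<and> (\<forall>x. (\<forall>y. b x y = 0) \<longrightarrow> x = 0) \<and>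
     (\<forall>s x y. b x (s *v y) = b (J s *v x) y)"

definition norm_ideal :: "('k::field \<Rightarrow> int) \<Rightarrow> ('k vect \<Rightarrow> 'k vect \<Rightarrow> 'k) \<Rightarrow> 'k vect set \<Rightarrow> 'k set" where
  "norm_ideal v b L = o_span v (*) ((\<lambda>x. b x x) ` L)"

definition vlattice :: "('k::field \<Rightarrow> int) \<Rightarrow> 'k vect set \<Rightarrow> bool" where
  "vlattice v L \<longleftrightarrow> o_lattice v (*s) L"

definition a_maximal :: "('k::field \<Rightarrow> int) \<Rightarrow> ('k vect \<Rightarrow> 'k vect \<Rightarrow> 'k) \<Rightarrow> 'k set \<Rightarrow> 'k vect set \<Rightarrow> bool" where
  "a_maximal v b a L \<longleftrightarrow> vlattice v L \<and> norm_ideal v b L \<subseteq> a \<and>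
     \<not> (\<exists>L'. vlattice v L' \<and> L \<subset> L' \<and> norm_ideal v b L' \<subseteq> a)"

definition dual_lattice :: "('k::field \<Rightarrow> int) \<Rightarrow> ('k vect \<Rightarrow> 'k vect \<Rightarrow> 'k) \<Rightarrow> 'k vect set \<Rightarrow> 'k vect set" where
  "dual_lattice v b L = {x. \<forall>y\<in>L. b x y \<in> oring v}"

definition End_lat :: "'k::field vect set \<Rightarrow> 'k quat set" where
  "End_lat L = {s. \<forall>x\<in>L. s *v x \<in> L}"

section \<open>Orders\<close>

definition quat_order :: "('k::field \<Rightarrow> int) \<Rightarrow> 'k quat set \<Rightarrow> bool" where
  "quat_order v Ord \<longleftrightarrow> o_lattice v hsmul Ord \<and> mat 1 \<in> Ord \<and> (\<forall>A\<in>Ord. \<forall>B\<in>Ord. A ** B \<in> Ord)"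

definition dagger_order :: "('k::field \<Rightarrow> int) \<Rightarrow> ('k quat \<Rightarrow> 'k quat) \<Rightarrow> 'k quat set \<Rightarrow> bool" where
  "dagger_order v J Ord \<longleftrightarrow> quat_order v Ord \<and> J ` Ord = Ord"

definition max_dagger_order :: "('k::field \<Rightarrow> int) \<Rightarrow> ('k quat \<Rightarrow> 'k quat) \<Rightarrow> 'k quat set \<Rightarrow> bool" where
  "max_dagger_order v J Ord \<longleftrightarrow> dagger_order v J Ord \<and> \<not> (\<exists>Ord'. dagger_order v J Ord' \<and> Ord \<subset> Ord')"

definition auto_inv :: "('k::field quat \<Rightarrow> 'k quat) \<Rightarrow> ('k quat \<Rightarrow> 'k quat) \<Rightarrow> bool" where
  "auto_inv J \<phi> \<longleftrightarrow> bij \<phi> \<and>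
     (\<forall>A B. \<phi> (A + B) = \<phi> A + \<phi> B) \<and> (\<forall>c A. \<phi> (hsmul c A) = hsmul c (\<phi> A)) \<and>
     (\<forall>A B. \<phi> (A ** B) = \<phi> A ** \<phi> B) \<and> \<phi> (mat 1) = mat 1 \<and>
     (\<forall>A. \<phi> (J A) = J (\<phi> A))"

section \<open>Discriminants\<close>

text \<open>Discriminant ideal d(Ord): generated by det(trd(x_i x_j)) for x_1..x_4 in Ord (trd = trace,
  nrd = det in H = End(V)).  The reduced discriminant is the fractional ideal whose square is d(Ord).\<close>
definition disc_ideal :: "('k::field \<Rightarrow> int) \<Rightarrow> 'k quat set \<Rightarrow> 'k set" where
  "disc_ideal v Ord = o_span v (*)
     {det (\<chi> (i::4) (j::4). trace (x i ** x j)) | x. \<forall>i. x i \<in> Ord}"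

definition ideal_mult :: "('k::field \<Rightarrow> int) \<Rightarrow> 'k set \<Rightarrow> 'k set \<Rightarrow> 'k set" where
  "ideal_mult v I K = o_span v (*) {a * c | a c. a \<in> I \<and> c \<in> K}"

definition reduced_disc :: "('k::field \<Rightarrow> int) \<Rightarrow> 'k quat set \<Rightarrow> 'k set" where
  "reduced_disc v Ord = (THE I. frac_ideal v I \<and> ideal_mult v I I = disc_ideal v Ord)"

text \<open>disc(J) is the square class nrd(h)(F^x)^2 for nonzero h with J h = -h; since the
  (-1)-eigenspace is one-dimensional, the set of all such nrd(h) is exactly that square class.
  iota of it is the ideal of o generated by its intersection with o.\<close>
definition disc_inv_class :: "('k::field quat \<Rightarrow> 'k quat) \<Rightarrow> 'k set" where
  "disc_inv_class J = {det h | h. h \<noteq> 0 \<and> J h = - h}"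

definition iota :: "('k::field \<Rightarrow> int) \<Rightarrow> 'k set \<Rightarrow> 'k set" where
  "iota v C = o_span v (*) (C \<inter> oring v)"

text \<open>disc(H) = o for split H.\<close>
definition disc_H_split :: "('k::field \<Rightarrow> int) \<Rightarrow> 'k set" where
  "disc_H_split v = oring v"

end

theory Submission
  imports Defs
begin

text \<open>A \<open>\<ddagger>\<close>-order \<open>R\<close> stabilizes the lattice \<open>R x\<^sub>0\<close>, which has an orthogonal basis because 2 is a
unit. In the coordinates of this basis \<open>R\<close> is integral, and since the adjoint
\<open>A \<mapsto> D\<inverse> A\<^sup>T D\<close>, where \<open>D = diag(u\<^sub>1, u\<^sub>2)\<close> is the Gram matrix, is integral on \<open>R\<close> as well, the upper
right entry lies in the ideal generated by \<open>u\<^sub>2 / u\<^sub>1\<close>. Rescaling the two basis vectors makes the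
valuations of \<open>u\<^sub>1\<close> and \<open>u\<^sub>2\<close> equal to 0 or 1 and keeps \<open>R\<close> inside the order of matrices which are
integral and upper right divisible by \<open>u\<^sub>2 / u\<^sub>1\<close>. That order is itself a \<open>\<ddagger>\<close>-order, so a maximal \<open>R\<close> is equal
to it. For two such frames, the Gram determinants agree up to a square, hence after multiplying
one basis vector by a unit the frames differ by a similitude, and conjugation by it is the
required automorphism.\<close>

section \<open>Valuations, modules over the valuation ring, and principal ideals\<close>

interpretation hs: vector_space "hsmul :: 'k::field \<Rightarrow> 'k quat \<Rightarrow> 'k quat"
  by unfold_locales (simp_all add: hsmul_def vec_eq_iff algebra_simps)

section \<open>Arithmetic of a discrete valuation\<close>

locale valued_field =
  fixes v :: "'k::field \<Rightarrow> int"
  assumes valuation: "discrete_valuation v"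
begin

lemma v_mult: "x \<noteq> 0 \<Longrightarrow> y \<noteq> 0 \<Longrightarrow> v (x * y) = v x + v y"
  using valuation by (auto simp: discrete_valuation_def)

lemma v_one [simp]: "v 1 = 0"
  using v_mult[of 1 1] by simp

lemma v_uminus [simp]: "v (- x) = v x"
proof (cases "x = 0")
  case False
  have "2 * v (- 1) = 0" using v_mult[of "-1" "-1"] by simp
  then show ?thesis using v_mult[of "-1" x] False by simp
qed simp

lemma v_divide: "x \<noteq> 0 \<Longrightarrow> y \<noteq> 0 \<Longrightarrow> v (x / y) = v x - v y"
  using v_mult[of "x / y" y] by simp

lemma v_square: "x \<noteq> 0 \<Longrightarrow> v (x\<^sup>2) = 2 * v x"
  by (simp add: power2_eq_square v_mult)

lemma ex_v_eq:
  obtains x where "x \<noteq> 0" "v x = m"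
proof -
  obtain p where p: "p \<noteq> 0" "v p = 1" using valuation by (auto simp: discrete_valuation_def)
  have pow: "v (p ^ n) = int n" for n by (induction n) (auto simp: p v_mult)
  show thesis
  proof (cases "m \<ge> 0")
    case True
    then show thesis using that[of "p ^ nat m"] p pow by simp
  next
    case False
    then show thesis using that[of "1 / p ^ nat (- m)"] p pow by (simp add: v_divide del: power_one_over)
  qed
qed

text \<open>Since the value of \<open>v\<close> at 0 carries no meaning, estimates are phrased as
  membership in the \<open>n\<close>-th power of the maximal ideal, which contains 0 for every
  \<open>n\<close>.\<close>

lemma vsmall_0 [simp]: "vsmall v n 0"
  by (simp add: vsmall_def)

lemma vsmall_add: "vsmall v n x \<Longrightarrow> vsmall v n y \<Longrightarrow> vsmall v n (x + y)"
  using valuation unfolding vsmall_def discrete_valuation_def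
  by (metis add.right_neutral add_0 min.coboundedI1 min.coboundedI2 min_def order_trans)

lemma vsmall_uminus [simp]: "vsmall v n (- x) = vsmall v n x"
  by (simp add: vsmall_def)

lemma vsmall_diff: "vsmall v n x \<Longrightarrow> vsmall v n y \<Longrightarrow> vsmall v n (x - y)"
  using vsmall_add[of n x "- y"] by simp

lemma vsmall_mult: "vsmall v m x \<Longrightarrow> vsmall v n y \<Longrightarrow> vsmall v (m + n) (x * y)"
  by (cases "x = 0 \<or> y = 0") (auto simp: vsmall_def v_mult)

lemma vsmall_mult_iff: "c \<noteq> 0 \<Longrightarrow> vsmall v n (c * x) \<longleftrightarrow> vsmall v (n - v c) x"
  by (cases "x = 0") (auto simp: vsmall_def v_mult)

lemma vsmall_divide_iff: "c \<noteq> 0 \<Longrightarrow> vsmall v n (x / c) \<longleftrightarrow> vsmall v (n + v c) x"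
  by (cases "x = 0") (auto simp: vsmall_def v_divide)

lemma vsmall_mono: "m \<le> n \<Longrightarrow> vsmall v n x \<Longrightarrow> vsmall v m x"
  by (auto simp: vsmall_def)

lemma vsmall_v [simp]: "vsmall v (v x) x"
  by (simp add: vsmall_def)

lemma vsmall_sum: "(\<And>i. i \<in> I \<Longrightarrow> vsmall v n (f i)) \<Longrightarrow> vsmall v n (sum f I)"
  by (induction I rule: infinite_finite_induct) (auto simp: vsmall_add)

lemma mem_oring: "x \<in> oring v \<longleftrightarrow> vsmall v 0 x"
  by (simp add: oring_def vsmall_def)

lemma vsmall_smult: "c \<in> oring v \<Longrightarrow> vsmall v n x \<Longrightarrow> vsmall v n (c * x)"
  using vsmall_mult[of 0 c n x] by (simp add: mem_oring)

lemma oring_1 [simp]: "1 \<in> oring v" and oring_0 [simp]: "0 \<in> oring v"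
  by (simp_all add: oring_def)

lemma oring_add: "x \<in> oring v \<Longrightarrow> y \<in> oring v \<Longrightarrow> x + y \<in> oring v"
  by (simp add: mem_oring vsmall_add)

lemma oring_mult: "x \<in> oring v \<Longrightarrow> y \<in> oring v \<Longrightarrow> x * y \<in> oring v"
  using vsmall_mult[of 0 x 0 y] by (simp add: mem_oring)

lemma finite_vsmall:
  assumes "finite S" obtains n where "\<And>x. x \<in> S \<Longrightarrow> vsmall v n x"
proof -
  have "\<exists>n. \<forall>x\<in>S. vsmall v n x" using assms
  proof (induction S)
    case (insert x S)
    then obtain n where "\<forall>y\<in>S. vsmall v n y" by blast
    then have "\<forall>y\<in>insert x S. vsmall v (min n (v x)) y"
      by (auto intro: vsmall_mono[of "min n (v x)" n] vsmall_mono[of "min n (v x)" "v x"])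
    then show ?case by blast
  qed simp
  then show thesis using that by blast
qed

text \<open>Discreteness turns boundedness into an attained minimum. This later selects generators
  of ideals and vectors whose norm has least valuation.\<close>

lemma v_minimal_element:
  assumes "\<And>x. x \<in> S \<Longrightarrow> vsmall v n x" "s \<in> S" "s \<noteq> 0"
  obtains x where "x \<in> S" "x \<noteq> 0" "\<And>y. y \<in> S \<Longrightarrow> vsmall v (v x) y"
proof -
  \<comment> \<open>Shifting by the lower bound \<open>n\<close> moves the valuations into the
    natural numbers, which are well-ordered.\<close>
  obtain x where x: "x \<in> S \<and> x \<noteq> 0"
    and least: "\<forall>y. y \<in> S \<and> y \<noteq> 0 \<longrightarrow> nat (v x - n) \<le> nat (v y - n)"
    using ex_has_least_nat[of "\<lambda>x. x \<in> S \<and> x \<noteq> 0" s "\<lambda>x. nat (v x - n)"] assms(2,3) by blast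
  have "v x \<le> v y" if "y \<in> S" "y \<noteq> 0" for y
  proof -
    have "n \<le> v y" "n \<le> v x" using assms(1) that x by (auto simp: vsmall_def)
    moreover have "nat (v x - n) \<le> nat (v y - n)" using least that by blast
    ultimately show ?thesis by linarith
  qed
  then show thesis using that[of x] x by (auto simp: vsmall_def)
qed

section \<open>Modules and fractional ideals over the valuation ring\<close>

definition o_submodule :: "('k \<Rightarrow> 'b \<Rightarrow> 'b) \<Rightarrow> 'b::ab_group_add set \<Rightarrow> bool" where
  "o_submodule sm M \<longleftrightarrow> 0 \<in> M \<and> (\<forall>x\<in>M. \<forall>y\<in>M. x + y \<in> M) \<and> (\<forall>c\<in>oring v. \<forall>x\<in>M. sm c x \<in> M)"

lemma o_span_minimal:
  assumes "o_submodule sm M" "S \<subseteq> M"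
  shows "o_span v sm S \<subseteq> M"
proof
  fix x assume "x \<in> o_span v sm S"
  then obtain A c where A: "finite A" "A \<subseteq> S" "\<forall>a\<in>A. c a \<in> oring v" "x = (\<Sum>a\<in>A. sm (c a) a)"
    by (auto simp: o_span_def)
  have "(\<Sum>a\<in>A. sm (c a) a) \<in> M" using A(1-3)
    by (induction A) (use assms in \<open>auto simp: o_submodule_def\<close>)
  then show "x \<in> M" using A by simp
qed

context
  fixes sm :: "'k \<Rightarrow> 'b \<Rightarrow> 'b::ab_group_add"
  assumes vs: "vector_space sm"
begin

interpretation sm: vector_space sm by (rule vs)

lemma o_spanI:
  "finite A \<Longrightarrow> A \<subseteq> S \<Longrightarrow> (\<And>a. a \<in> A \<Longrightarrow> c a \<in> oring v) \<Longrightarrow> (\<Sum>a\<in>A. sm (c a) a) \<in> o_span v sm S"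
  unfolding o_span_def by blast

lemma o_span_base: "x \<in> S \<Longrightarrow> x \<in> o_span v sm S"
  using o_spanI[of "{x}" S "\<lambda>_. 1"] by simp

lemma o_submodule_o_span: "o_submodule sm (o_span v sm S)"
  unfolding o_submodule_def
proof (intro conjI ballI)
  show "0 \<in> o_span v sm S" using o_spanI[of "{}" S] by simp
next
  fix x y assume "x \<in> o_span v sm S" "y \<in> o_span v sm S"
  then obtain A c B d where A: "finite A" "A \<subseteq> S" "\<forall>a\<in>A. c a \<in> oring v" "x = (\<Sum>a\<in>A. sm (c a) a)"
    and B: "finite B" "B \<subseteq> S" "\<forall>a\<in>B. d a \<in> oring v" "y = (\<Sum>a\<in>B. sm (d a) a)"
    by (auto simp: o_span_def)
  \<comment> \<open>Both coefficient families are extended by 0, so that the two sums run over the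
    same index set.\<close>
  define c' where "c' a = (if a \<in> A then c a else 0)" for a
  define d' where "d' a = (if a \<in> B then d a else 0)" for a
  have "x = (\<Sum>a\<in>A \<union> B. sm (c' a) a)" "y = (\<Sum>a\<in>A \<union> B. sm (d' a) a)"
    unfolding A(4) B(4) using A(1) B(1)
    by (auto intro!: sum.mono_neutral_cong_left simp: c'_def d'_def)
  then have "x + y = (\<Sum>a\<in>A \<union> B. sm (c' a + d' a) a)"
    by (simp add: sm.scale_left_distrib sum.distrib)
  moreover have "\<forall>a\<in>A \<union> B. c' a + d' a \<in> oring v"
    using A(3) B(3) by (auto simp: c'_def d'_def intro: oring_add)
  ultimately show "x + y \<in> o_span v sm S"
    using o_spanI[of "A \<union> B" S "\<lambda>a. c' a + d' a"] A(1,2) B(1,2) by simp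
next
  fix r x assume r: "r \<in> oring v" and "x \<in> o_span v sm S"
  then obtain A c where "finite A" "A \<subseteq> S" "\<forall>a\<in>A. c a \<in> oring v" "x = (\<Sum>a\<in>A. sm (c a) a)"
    by (auto simp: o_span_def)
  then show "sm r x \<in> o_span v sm S"
    using r o_spanI[of A S "\<lambda>a. r * c a"] by (simp add: sm.scale_sum_right oring_mult)
qed

lemma o_lattice_submodule: "o_lattice v sm L \<Longrightarrow> o_submodule sm L"
  unfolding o_lattice_def using o_submodule_o_span by blast

end

text \<open>The \<open>m\<close>-th power of the maximal ideal, with negative exponents
  allowed.\<close>

definition pideal :: "int \<Rightarrow> 'k set" where
  "pideal m = {x. vsmall v m x}"

lemma pideal_0: "pideal 0 = oring v"
  by (auto simp: pideal_def mem_oring)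

lemma pideal_subset_iff: "pideal m \<subseteq> pideal n \<longleftrightarrow> n \<le> m"
proof
  assume *: "pideal m \<subseteq> pideal n"
  obtain x where "x \<noteq> 0" "v x = m" by (rule ex_v_eq)
  with * show "n \<le> m" by (auto simp: pideal_def vsmall_def)
qed (auto simp: pideal_def vsmall_def)

lemma pideal_eq_iff: "pideal m = pideal n \<longleftrightarrow> m = n"
  by (metis pideal_subset_iff order_antisym order_refl)

lemma o_submodule_pideal: "o_submodule (*) (pideal m)"
  by (auto simp: o_submodule_def pideal_def vsmall_add vsmall_smult)

text \<open>An element of least valuation divides all the others, so it alone generates the
  ideal.\<close>

lemma o_span_eq_pideal:
  assumes "S \<subseteq> pideal m" "s \<in> S" "s \<noteq> 0" "v s = m"
  shows "o_span v (*) S = pideal m"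
proof
  show "o_span v (*) S \<subseteq> pideal m"
    by (rule o_span_minimal[OF o_submodule_pideal assms(1)])
  note sub = o_submodule_o_span[OF vector_space_over_itself.vector_space_axioms, of S]
  show "pideal m \<subseteq> o_span v (*) S"
  proof
    fix x assume "x \<in> pideal m"
    then have "x / s \<in> oring v"
      using assms by (simp add: pideal_def mem_oring vsmall_divide_iff)
    moreover have "s \<in> o_span v (*) S"
      by (rule o_span_base[OF vector_space_over_itself.vector_space_axioms assms(2)])
    ultimately have "x / s * s \<in> o_span v (*) S"
      using sub unfolding o_submodule_def by blast
    then show "x \<in> o_span v (*) S" using assms by simp
  qed
qed

lemma frac_ideal_iff: "frac_ideal v I \<longleftrightarrow> (\<exists>m. I = pideal m)"
proof
  assume "frac_ideal v I"
  then obtain S where S: "finite S" "I = o_span v (*) S" "I \<noteq> {0}" by (auto simp: frac_ideal_def)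
  have "\<exists>s\<in>S. s \<noteq> 0"
  proof (rule ccontr)
    assume "\<not> ?thesis"
    then have "S \<subseteq> {0}" by blast
    then have "I \<subseteq> {0}" unfolding S(2) by (intro o_span_minimal) (auto simp: o_submodule_def)
    moreover have "0 \<in> I"
      using o_submodule_o_span[OF vector_space_over_itself.vector_space_axioms, of S] S(2)
      by (simp add: o_submodule_def)
    ultimately show False using S(3) by blast
  qed
  then obtain s0 where s0: "s0 \<in> S" "s0 \<noteq> 0" by blast
  obtain n where n: "\<And>x. x \<in> S \<Longrightarrow> vsmall v n x" by (rule finite_vsmall[OF S(1)]) blast
  obtain s where "s \<in> S" "s \<noteq> 0" "\<forall>y\<in>S. vsmall v (v s) y"
    by (rule v_minimal_element[OF n s0]) auto
  then have "I = pideal (v s)" unfolding S(2)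
    by (intro o_span_eq_pideal) (auto simp: pideal_def)
  then show "\<exists>m. I = pideal m" ..
next
  assume "\<exists>m. I = pideal m"
  then obtain m where I: "I = pideal m" ..
  obtain x where x: "x \<noteq> 0" "v x = m" by (rule ex_v_eq)
  have "I = o_span v (*) {x}" unfolding I
    by (rule o_span_eq_pideal[symmetric]) (use x in \<open>auto simp: pideal_def vsmall_def\<close>)
  moreover have "x \<in> I" using x by (simp add: I pideal_def vsmall_def)
  ultimately show "frac_ideal v I" using x(1) unfolding frac_ideal_def by blast
qed

lemma ideal_mult_pideal: "ideal_mult v (pideal m) (pideal n) = pideal (m + n)"
proof -
  obtain x y where xy: "x \<noteq> 0" "v x = m" "y \<noteq> 0" "v y = n" by (metis ex_v_eq)
  show ?thesis unfolding ideal_mult_def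
  proof (rule o_span_eq_pideal)
    show "x * y \<in> {a * c |a c. a \<in> pideal m \<and> c \<in> pideal n}"
      using xy by (auto simp: pideal_def vsmall_def)
  qed (use xy in \<open>auto simp: pideal_def vsmall_mult v_mult\<close>)
qed

text \<open>Squaring doubles the exponent and the exponent determines the ideal, so the square root
  of the discriminant ideal is unique.\<close>

lemma reduced_disc_eq_pideal:
  assumes "disc_ideal v O' = pideal (2 * m)"
  shows "reduced_disc v O' = pideal m"
  unfolding reduced_disc_def assms
  by (rule the_equality) (auto simp: frac_ideal_iff ideal_mult_pideal pideal_eq_iff)

end

section \<open>Orthogonal bases adapted to a lattice\<close>

definition mat2 :: "'k \<Rightarrow> 'k \<Rightarrow> 'k \<Rightarrow> 'k \<Rightarrow> 'k::field quat" where
  "mat2 a b c d = vector [vector [a, b], vector [c, d]]"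

lemma mat2_nth [simp]:
  "mat2 a b c d $ 1 $ 1 = a" "mat2 a b c d $ 1 $ 2 = b"
  "mat2 a b c d $ 2 $ 1 = c" "mat2 a b c d $ 2 $ 2 = d"
  by (simp_all add: mat2_def)

lemma quat_eq_iff:
  "(A :: 'k::field quat) = B \<longleftrightarrow>
     A$1$1 = B$1$1 \<and> A$1$2 = B$1$2 \<and> A$2$1 = B$2$1 \<and> A$2$2 = B$2$2"
  by (auto simp: vec_eq_iff forall_2)

lemma vect_eq_iff: "(x :: 'k::field vect) = y \<longleftrightarrow> x$1 = y$1 \<and> x$2 = y$2"
  by (auto simp: vec_eq_iff forall_2)

lemma quat_mult_nth: "((A :: 'k::field quat) ** B) $ i $ j = A$i$1 * B$1$j + A$i$2 * B$2$j"
  by (simp add: matrix_matrix_mult_def sum_2)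

lemma quat_vect_nth: "((A :: 'k::field quat) *v x) $ i = A$i$1 * x$1 + A$i$2 * x$2"
  by (simp add: matrix_vector_mult_def sum_2)

lemma mat_1_nth: "(mat 1 :: 'k::field quat) $ 1 $ 1 = 1" "(mat 1 :: 'k quat) $ 1 $ 2 = 0"
  "(mat 1 :: 'k quat) $ 2 $ 1 = 0" "(mat 1 :: 'k quat) $ 2 $ 2 = 1"
  by (simp_all add: mat_def)

lemmas quat_simps = quat_eq_iff vect_eq_iff quat_mult_nth quat_vect_nth mat_1_nth

lemma hsmul_nth [simp]: "hsmul c A $ i $ j = c * A $ i $ j"
  by (simp add: hsmul_def)

lemma hsmul_mult_left: "hsmul c A ** B = hsmul c (A ** B)"
  and hsmul_mult_right: "A ** hsmul c B = hsmul c (A ** B)"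
  and hsmul_vector: "hsmul c A *v x = c *s (A *v x)"
  by (simp_all add: quat_simps algebra_simps)

lemma invertible_pair_cancel:
  fixes P :: "'k::field quat"
  assumes "P ** Q = mat 1"
  shows "P ** (Q ** A) = A" "P *v (Q *v x) = x" "A ** P ** Q = A"
proof -
  have "Q ** P = mat 1" using assms matrix_left_right_inverse by blast
  then show "P ** (Q ** A) = A" "P *v (Q *v x) = x" "A ** P ** Q = A"
    using assms by (simp_all add: matrix_mul_assoc matrix_vector_mul_assoc flip: matrix_mul_assoc[of A])
qed

section \<open>The adjoint form and orthogonal splitting of lattices\<close>

locale adjoint_form_space = valued_field v for v :: "'k::field \<Rightarrow> int" +
  fixes J :: "'k quat \<Rightarrow> 'k quat" and b :: "'k vect \<Rightarrow> 'k vect \<Rightarrow> 'k"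
  assumes nondyadic: "nondyadic v" and adjoint: "adjoint_form J b"
begin

lemma two_neq_0 [simp]: "(2::'k) \<noteq> 0" and v_two [simp]: "v 2 = 0"
  using nondyadic by (auto simp: nondyadic_def)

lemmas b_props = adjoint[unfolded adjoint_form_def]

lemmas b_add_left = b_props[THEN conjunct1, rule_format]
lemmas b_scale_left = b_props[THEN conjunct2, THEN conjunct1, rule_format]
lemmas b_sym = b_props[THEN conjunct2, THEN conjunct2, THEN conjunct1, rule_format]
lemmas b_nondegenerate =
  b_props[THEN conjunct2, THEN conjunct2, THEN conjunct2, THEN conjunct1, rule_format]
lemmas b_adjoint =
  b_props[THEN conjunct2, THEN conjunct2, THEN conjunct2, THEN conjunct2, rule_format]

lemma b_add_right: "b x (y + z) = b x y + b x z"
  using b_add_left[of y z x] by (simp add: b_sym[of x])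

lemma b_scale_right: "b x (c *s y) = c * b x y"
  using b_scale_left[of c y x] by (simp add: b_sym[of x])

lemma b_zero_left [simp]: "b 0 x = 0" and b_zero_right [simp]: "b x 0 = 0"
  using b_scale_left[of 0 0 x] b_scale_right[of x 0 0] by simp_all

lemma b_diff_left: "b (x - y) z = b x z - b y z"
  using b_add_left[of "x - y" y z] by simp

lemma b_diff_right: "b x (y - z) = b x y - b x z"
  using b_add_right[of x "y - z" z] by simp

lemmas b_bilinear = b_add_left b_add_right b_scale_left b_scale_right b_diff_left b_diff_right

text \<open>Nondegeneracy makes adjoints unique. This is how \<open>J\<close> is later computed in
  coordinates.\<close>

lemma J_eqI:
  assumes "\<And>x y. b x (s *v y) = b (t *v x) y"
  shows "J s = t"
proof -
  have "J s *v x = t *v x" for x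
    using b_nondegenerate[of "J s *v x - t *v x"] assms by (simp add: b_adjoint[symmetric] b_diff_left)
  then show ?thesis by (simp add: matrix_eq)
qed

lemma J_J: "J (J s) = s"
proof (rule J_eqI)
  fix x y
  show "b x (J s *v y) = b (s *v x) y"
    using b_adjoint[of y s x] b_sym[of x "J s *v y"] b_sym[of y "s *v x"] by simp
qed

lemma subspace_b: "vec.subspace {y. b x y = 0}"
  by (rule vec.subspaceI) (simp_all add: b_bilinear)

text \<open>Polarization bounds \<open>2 * b x y\<close>, and 2 is a unit. Hence the norms on a
  lattice control all its inner products.\<close>

lemma vsmall_polarize:
  assumes "vsmall v n (b (x + y) (x + y))" "vsmall v n (b x x)" "vsmall v n (b y y)"
  shows "vsmall v n (b x y)"
proof -
  have "2 * b x y = b (x + y) (x + y) - b x x - b y y"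
    by (simp add: b_add_left b_add_right b_sym[of y x])
  then have "vsmall v n (2 * b x y)" using assms by (simp add: vsmall_diff)
  then show ?thesis by (simp add: vsmall_mult_iff)
qed

text \<open>The functional \<open>b e\<close> is nonzero, so its kernel is a line. If a generator
  \<open>f\<close> of it were isotropic, it would be orthogonal to both \<open>e\<close> and itself,
  against nondegeneracy.\<close>

lemma ex_orthogonal_complement:
  assumes "b e e \<noteq> 0"
  obtains f where "b e f = 0" "b f f \<noteq> 0" "\<And>y. \<exists>c. y = (b e y / b e e) *s e + c *s f"
proof -
  define r where "r = b e (axis 1 1)"
  define s where "s = b e (axis 2 1)"
  have b_e: "b e y = r * y$1 + s * y$2" for y
  proof -
    have "y = (y$1) *s axis 1 1 + (y$2) *s axis 2 1" by (simp add: vect_eq_iff axis_def)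
    then have "b e y = b e ((y$1) *s axis 1 1 + (y$2) *s axis 2 1)" by simp
    then show ?thesis by (simp only: b_bilinear r_def s_def) (simp add: mult.commute)
  qed
  have rs: "r \<noteq> 0 \<or> s \<noteq> 0" using assms b_e by auto
  \<comment> \<open>The functional has coordinates \<open>r\<close> and \<open>s\<close>, so this
    vector spans its kernel.\<close>
  define f :: "'k vect" where "f = vector [- s, r]"
  have f: "f \<noteq> 0" "b e f = 0" using rs by (auto simp: f_def vect_eq_iff b_e)
  have kernel: "\<exists>c. w = c *s f" if "b e w = 0" for w
  proof (cases "r = 0")
    case True
    then have "w = (- w$1 / s) *s f" using rs that by (auto simp: b_e vect_eq_iff f_def)
    then show ?thesis ..
  next
    case False
    have "r * w$1 = - (s * w$2)" using that b_e[of w] by (simp add: add_eq_0_iff)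
    then have "w = (w$2 / r) *s f" using False
      by (simp add: vect_eq_iff f_def field_simps)
    then show ?thesis ..
  qed
  have decomp: "\<exists>c. y = (b e y / b e e) *s e + c *s f" for y
  proof -
    have "b e (y - (b e y / b e e) *s e) = 0"
      using assms by (simp add: b_bilinear)
    then obtain c where "y - (b e y / b e e) *s e = c *s f" using kernel by blast
    then show ?thesis by (metis add.commute diff_add_cancel)
  qed
  have "b f f \<noteq> 0"
  proof
    assume "b f f = 0"
    have "b f y = 0" for y
    proof -
      obtain c where "y = (b e y / b e e) *s e + c *s f" using decomp by blast
      then have "b f y = b f ((b e y / b e e) *s e + c *s f)" by simp
      also have "\<dots> = 0" using f(2) b_sym[of f e] \<open>b f f = 0\<close> by (simp add: b_bilinear)
      finally show ?thesis .
    qed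
    then show False using b_nondegenerate f(1) by blast
  qed
  then show thesis using that f(2) decomp by blast
qed

text \<open>Choose \<open>e1\<close> in \<open>L\<close> such that \<open>b e1 e1\<close> has least
  valuation among all inner products on \<open>L\<close>. Projection to \<open>e1\<close> then has
  integral coefficients, so \<open>L\<close> splits off the multiples of \<open>e1\<close>. What
  remains lies on a line and is generated by a vector \<open>e2\<close> whose norm has least
  valuation.\<close>

lemma ex_orthogonal_basis:
  assumes L: "o_submodule (*s) L" and span: "vec.span L = UNIV"
    and bounded: "\<And>x y. x \<in> L \<Longrightarrow> y \<in> L \<Longrightarrow> vsmall v n (b x y)"
  obtains e1 e2 where "b e1 e2 = 0" "b e1 e1 \<noteq> 0" "b e2 e2 \<noteq> 0"
    "v (b e1 e1) \<le> v (b e2 e2)" "L = {r *s e1 + s *s e2 | r s. r \<in> oring v \<and> s \<in> oring v}"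
proof -
  have L_add: "x + y \<in> L" if "x \<in> L" "y \<in> L" for x y using L that by (simp add: o_submodule_def)
  have L_scale: "c *s x \<in> L" if "c \<in> oring v" "x \<in> L" for c x using L that by (simp add: o_submodule_def)
  have not_orth: "\<exists>y\<in>L. b x y \<noteq> 0" if "x \<noteq> 0" for x
  proof (rule ccontr)
    assume "\<not> ?thesis"
    then have "vec.span L \<subseteq> {y. b x y = 0}"
      by (intro vec.span_minimal subspace_b) blast
    then show False using span that b_nondegenerate by blast
  qed
  let ?S = "{b x y | x y. x \<in> L \<and> y \<in> L}"
  have "\<exists>y\<in>L. y \<noteq> 0"
  proof (rule ccontr)
    assume "\<not> ?thesis"
    then have "vec.span L \<subseteq> {0}" by (intro vec.span_minimal) auto
    moreover have "axis 1 1 \<noteq> (0 :: 'k vect)" by (simp add: axis_eq_0_iff)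
    ultimately show False using span by blast
  qed
  then obtain s where s: "s \<in> ?S" "s \<noteq> 0" using not_orth by blast
  have S_bounded: "vsmall v n z" if "z \<in> ?S" for z using that bounded by auto
  obtain m where m: "m \<in> ?S" "m \<noteq> 0" "\<forall>z\<in>?S. vsmall v (v m) z"
    by (rule v_minimal_element[OF S_bounded s]) blast+
  \<comment> \<open>If every norm had valuation above the minimum \<open>v m\<close>, polarization
    would push every inner product above it too, including \<open>m\<close> itself.\<close>
  have "\<exists>e\<in>L. \<not> vsmall v (v m + 1) (b e e)"
  proof (rule ccontr)
    assume "\<not> ?thesis"
    then have "\<forall>z\<in>?S. vsmall v (v m + 1) z" using L_add vsmall_polarize by blast
    then have "vsmall v (v m + 1) m" using m(1) by blast
    then show False using m(2) by (simp add: vsmall_def)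
  qed
  then obtain e1 where e1: "e1 \<in> L" "\<not> vsmall v (v m + 1) (b e1 e1)" by blast
  let ?u = "b e1 e1"
  have u: "?u \<noteq> 0" using e1(2) by auto
  have min: "vsmall v (v ?u) (b x y)" if "x \<in> L" "y \<in> L" for x y
    using m(3) that e1(2) u
    by (intro vsmall_mono[of "v ?u" "v m"]) (auto simp: vsmall_def)
  obtain f where f: "b e1 f = 0" "b f f \<noteq> 0" "\<And>y. \<exists>c. y = (b e1 y / ?u) *s e1 + c *s f"
    using ex_orthogonal_complement[OF u] by blast
  define N where "N = {z\<in>L. b e1 z = 0}"
  have coef: "b e1 y / ?u \<in> oring v" if "y \<in> L" for y
    using min[OF e1(1) that] u by (simp add: mem_oring vsmall_divide_iff)
  have proj: "y - (b e1 y / ?u) *s e1 \<in> N" if "y \<in> L" for y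
  proof -
    have "y + (-(b e1 y / ?u)) *s e1 \<in> L"
      using that coef[OF that] e1(1) by (intro L_add L_scale) (simp_all add: mem_oring)
    then show ?thesis unfolding N_def using u by (simp add: b_bilinear)
  qed
  have line: "\<exists>c. z = c *s f" if "z \<in> N" for z
    using f(3)[of z] that by (auto simp: N_def)
  have N_sq: "b z z \<noteq> 0" if "z \<in> N" "z \<noteq> 0" for z
    using line[OF that(1)] that(2) f(2) by (auto simp: b_bilinear)
  \<comment> \<open>A vector of \<open>L\<close> not orthogonal to \<open>f\<close> has a nonzero
    projection to \<open>N\<close>. So \<open>N\<close> contains a nonzero norm, as the choice of a
    minimum requires.\<close>
  have "f \<noteq> 0" using f(2) by auto
  then obtain y where y: "y \<in> L" "b f y \<noteq> 0" using not_orth by blast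
  let ?z = "y - (b e1 y / ?u) *s e1"
  have "b ?z f \<noteq> 0" using y f(1) by (simp add: b_bilinear b_sym[of y])
  then have "?z \<noteq> 0" by auto
  with proj[OF y(1)] N_sq have z: "b ?z ?z \<in> (\<lambda>z. b z z) ` N" "b ?z ?z \<noteq> 0" by blast+
  have N_bounded: "vsmall v n w" if "w \<in> (\<lambda>z. b z z) ` N" for w
    using that bounded by (auto simp: N_def)
  obtain w where w: "w \<in> (\<lambda>z. b z z) ` N" "w \<noteq> 0" "\<forall>y\<in>(\<lambda>z. b z z) ` N. vsmall v (v w) y"
    by (rule v_minimal_element[OF N_bounded z]) blast+
  then obtain e2 where e2: "e2 \<in> N" "w = b e2 e2" by blast
  have e2': "e2 \<in> L" "b e1 e2 = 0" "b e2 e2 \<noteq> 0" using e2 w by (auto simp: N_def)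
  have "L = {r *s e1 + s *s e2 | r s. r \<in> oring v \<and> s \<in> oring v}" (is "L = ?R")
  proof
    show "?R \<subseteq> L" using e1(1) e2'(1) L_add L_scale by blast
    show "L \<subseteq> ?R"
    proof
      fix x assume x: "x \<in> L"
      let ?p = "x - (b e1 x / ?u) *s e1"
      obtain c d where cd: "?p = c *s f" "e2 = d *s f" using line proj[OF x] e2(1) by blast
      have "d \<noteq> 0" using cd(2) e2'(3) by auto
      then have p: "?p = (c / d) *s e2" using cd by simp
      \<comment> \<open>Minimality of the norm of \<open>e2\<close> makes the square of the
        coefficient integral, hence also the coefficient.\<close>
      have "vsmall v (v w) (b ?p ?p)" using w(3) proj[OF x] by blast
      moreover have "b ?p ?p = w * (c / d)\<^sup>2"
        unfolding p e2(2) by (simp add: b_bilinear power2_eq_square)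
      ultimately have "vsmall v 0 ((c / d)\<^sup>2)" using w(2) by (simp add: vsmall_mult_iff)
      then have "c / d \<in> oring v"
        by (cases "c / d = 0") (auto simp: mem_oring vsmall_def v_square)
      moreover have "x = (b e1 x / ?u) *s e1 + (c / d) *s e2"
        unfolding p[symmetric] by simp
      ultimately show "x \<in> ?R" using coef[OF x] by blast
    qed
  qed
  moreover have "v ?u \<le> v (b e2 e2)" using min[OF e2'(1,1)] e2'(3) by (simp add: vsmall_def)
  ultimately show thesis using that u e2' by blast
qed

end

section \<open>Orthogonal frames adapted to an order\<close>

text \<open>For \<open>n\<close> \<ge> 0 this is the standard Eichler order whose level is the
  \<open>n\<close>-th power of the maximal ideal; \<open>n = 0\<close> gives all integral
  matrices.\<close>

definition eichler :: "('k::field \<Rightarrow> int) \<Rightarrow> int \<Rightarrow> 'k quat set" where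
  "eichler v n = {A. vsmall v 0 (A$1$1) \<and> vsmall v n (A$1$2) \<and> vsmall v 0 (A$2$1) \<and> vsmall v 0 (A$2$2)}"

text \<open>For mutually inverse \<open>P\<close> and \<open>Q\<close> this is the conjugate of
  \<open>S\<close> by \<open>P\<close>; the preimage form reduces membership to a computation with
  \<open>Q ** s ** P\<close>.\<close>

definition conj_set :: "'k::field quat \<Rightarrow> 'k quat \<Rightarrow> 'k quat set \<Rightarrow> 'k quat set" where
  "conj_set P Q S = {s. Q ** s ** P \<in> S}"

text \<open>The columns of \<open>P\<close> form an orthogonal basis with norms \<open>u1\<close>
  and \<open>u2\<close>. The inverse \<open>Q\<close> is carried along because it gives the
  coordinates.\<close>

definition orth_frame ::
  "('k::field vect \<Rightarrow> 'k vect \<Rightarrow> 'k) \<Rightarrow> 'k quat \<Rightarrow> 'k quat \<Rightarrow> 'k \<Rightarrow> 'k \<Rightarrow> bool" where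
  "orth_frame b P Q u1 u2 \<longleftrightarrow> P ** Q = mat 1 \<and> Q ** P = mat 1 \<and> u1 \<noteq> 0 \<and> u2 \<noteq> 0 \<and>
     (\<forall>x y. b (P *v x) (P *v y) = u1 * x$1 * y$1 + u2 * x$2 * y$2)"

lemma orth_frame_change:
  assumes fr: "orth_frame b P Q u1 u2" and R: "R ** S = mat 1" and w: "w1 \<noteq> 0" "w2 \<noteq> 0"
    and form: "\<And>x y. u1 * (R *v x)$1 * (R *v y)$1 + u2 * (R *v x)$2 * (R *v y)$2 =
      w1 * x$1 * y$1 + w2 * x$2 * y$2"
  shows "orth_frame b (P ** R) (S ** Q) w1 w2"
proof -
  have "S ** R = mat 1" using R matrix_left_right_inverse by blast
  moreover have "P ** Q = mat 1" "Q ** P = mat 1" using fr by (auto simp: orth_frame_def)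
  ultimately have "(P ** R) ** (S ** Q) = mat 1" "(S ** Q) ** (P ** R) = mat 1"
    using R by (simp_all add: invertible_pair_cancel flip: matrix_mul_assoc)
  then show ?thesis
    using fr w form by (simp add: orth_frame_def flip: matrix_vector_mul_assoc)
qed

section \<open>The involution and its orders in frame coordinates\<close>

context adjoint_form_space
begin

lemma ex_orth_frame:
  assumes "b e1 e2 = 0" "b e1 e1 \<noteq> 0" "b e2 e2 \<noteq> 0"
  obtains P Q where "orth_frame b P Q (b e1 e1) (b e2 e2)" "\<And>x. P *v x = x$1 *s e1 + x$2 *s e2"
proof -
  define P where "P = mat2 (e1$1) (e2$1) (e1$2) (e2$2)"
  have P: "P *v x = x$1 *s e1 + x$2 *s e2" for x
    by (simp add: P_def vect_eq_iff quat_vect_nth mult.commute)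
  have form: "b (P *v x) (P *v y) = b e1 e1 * x$1 * y$1 + b e2 e2 * x$2 * y$2" for x y
    using assms(1) b_sym[of e2 e1] by (simp add: P b_bilinear)
  have "inj ((*v) P)"
  proof (rule injI)
    fix x y assume "P *v x = P *v y"
    then have z: "P *v (x - y) = 0" by (simp add: vec.diff)
    \<comment> \<open>Pairing with the two basis vectors reads off the coordinates of
      \<open>x - y\<close> up to the nonzero norms.\<close>
    have "b (P *v (x - y)) (P *v axis 1 1) = 0" "b (P *v (x - y)) (P *v axis 2 1) = 0"
      unfolding z by simp_all
    then show "x = y" unfolding form using assms(2,3) by (simp add: vect_eq_iff axis_def)
  qed
  then obtain Q where "Q ** P = mat 1" using matrix_left_invertible_injective by blast
  moreover from this have "P ** Q = mat 1" using matrix_left_right_inverse by blast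
  ultimately show thesis using that P form assms by (simp add: orth_frame_def)
qed

context
  fixes P Q u1 u2
  assumes fr: "orth_frame b P Q u1 u2"
begin

lemma PQ: "P ** Q = mat 1" and QP: "Q ** P = mat 1" and u_neq_0: "u1 \<noteq> 0" "u2 \<noteq> 0"
  and frame_form: "b (P *v x) (P *v y) = u1 * x$1 * y$1 + u2 * x$2 * y$2"
  using fr by (simp_all add: orth_frame_def)

lemmas frame_cancel = invertible_pair_cancel[OF PQ] invertible_pair_cancel[OF QP] PQ QP

lemma frame_coords: "Q ** (P ** A ** Q) ** P = A" "P ** (Q ** s ** P) ** Q = s"
  by (simp_all add: frame_cancel flip: matrix_mul_assoc)

text \<open>In coordinates \<open>J\<close> is transposition conjugated by the diagonal Gram matrix,
  so it depends on the norms only through \<open>u2 / u1\<close>.\<close>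

lemma J_frame:
  "J (P ** A ** Q) = P ** mat2 (A$1$1) (A$2$1 * u2 / u1) (A$1$2 * u1 / u2) (A$2$2) ** Q"
proof (rule J_eqI)
  fix x y
  have xy: "x = P *v (Q *v x)" "y = P *v (Q *v y)" by (simp_all add: frame_cancel)
  have act: "(P ** B ** Q) *v (P *v z) = P *v (B *v z)" for B z
    by (simp add: matrix_vector_mul_assoc frame_cancel flip: matrix_mul_assoc)
  show "b x ((P ** A ** Q) *v y) =
    b ((P ** mat2 (A$1$1) (A$2$1 * u2 / u1) (A$1$2 * u1 / u2) (A$2$2) ** Q) *v x) y"
    by (subst (1 2) xy(1), subst (1 2) xy(2), unfold act frame_form)
      (use u_neq_0 in \<open>simp add: quat_vect_nth field_simps\<close>)
qed

lemma J_frame_coords: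
  "Q ** J s ** P = mat2 ((Q ** s ** P)$1$1) ((Q ** s ** P)$2$1 * u2 / u1)
     ((Q ** s ** P)$1$2 * u1 / u2) ((Q ** s ** P)$2$2)"
  using J_frame[of "Q ** s ** P"] unfolding frame_coords(2) by (simp add: frame_coords)

end

lemma orth_frame_scale:
  assumes "orth_frame b P Q u1 u2" "p \<noteq> 0" "q \<noteq> 0"
  shows "orth_frame b (P ** mat2 p 0 0 q) (mat2 (1/p) 0 0 (1/q) ** Q) (u1 * p\<^sup>2) (u2 * q\<^sup>2)"
  using assms u_neq_0[OF assms(1)]
  by (intro orth_frame_change[OF assms(1)]) (auto simp: quat_simps power2_eq_square)

lemma orth_frame_swap:
  assumes "orth_frame b P Q u1 u2"
  shows "orth_frame b (P ** mat2 0 1 1 0) (mat2 0 1 1 0 ** Q) u2 u1"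
  using u_neq_0[OF assms]
  by (intro orth_frame_change[OF assms]) (auto simp: quat_simps)

text \<open>The lattice \<open>L\<close> generated by the orbit of one vector under \<open>R\<close>
  is stable under \<open>R\<close>, so an orthogonal basis of \<open>L\<close> makes
  \<open>R\<close> integral. Stability of \<open>R\<close> under \<open>J\<close> then gives the
  condition on the upper right entry.\<close>

lemma order_adapted_frame:
  assumes ord: "dagger_order v J R"
  obtains P Q u1 u2 where "orth_frame b P Q u1 u2" "v u1 \<le> v u2" "R \<subseteq> conj_set P Q (eichler v (v u2 - v u1))"
proof -
  have lat: "o_lattice v hsmul R" and one: "mat 1 \<in> R" and mult: "A \<in> R \<Longrightarrow> B \<in> R \<Longrightarrow> A ** B \<in> R"
    and J_closed: "A \<in> R \<Longrightarrow> J A \<in> R" for A B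
    using ord by (auto simp: dagger_order_def quat_order_def)
  obtain S where S: "finite S" "R = o_span v hsmul S" and R_span: "hs.span R = UNIV"
    using lat by (auto simp: o_lattice_def)
  have sub: "o_submodule hsmul R" by (rule o_lattice_submodule[OF hs.vector_space_axioms lat])
  define x0 :: "'k vect" where "x0 = axis 1 1"
  define L where "L = (\<lambda>s. s *v x0) ` R"
  have L: "o_submodule (*s) L"
    unfolding o_submodule_def
  proof (intro conjI ballI)
    show "0 \<in> L" unfolding L_def using sub by (auto simp: o_submodule_def intro!: image_eqI[of _ _ 0])
  next
    fix x y assume "x \<in> L" "y \<in> L"
    then obtain s t where "s \<in> R" "t \<in> R" "x = s *v x0" "y = t *v x0" by (auto simp: L_def)
    then show "x + y \<in> L" unfolding L_def using sub
      by (auto simp: o_submodule_def matrix_vector_mult_add_rdistrib intro!: image_eqI[of _ _ "s + t"])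
  next
    fix c x assume "c \<in> oring v" "x \<in> L"
    then obtain s where "s \<in> R" "x = s *v x0" by (auto simp: L_def)
    then show "c *s x \<in> L" unfolding L_def using sub \<open>c \<in> oring v\<close>
      by (auto simp: o_submodule_def hsmul_vector intro!: image_eqI[of _ _ "hsmul c s"])
  qed
  have "hs.span R \<subseteq> {s. s *v x0 \<in> vec.span L}"
  proof (rule hs.span_minimal)
    show "R \<subseteq> {s. s *v x0 \<in> vec.span L}" by (auto simp: L_def intro: vec.span_base)
    show "hs.subspace {s. s *v x0 \<in> vec.span L}"
      by (rule hs.subspaceI) (auto simp: matrix_vector_mult_add_rdistrib hsmul_vector
          intro: vec.span_add vec.span_scale vec.span_zero)
  qed
  then have all: "s *v x0 \<in> vec.span L" for s using R_span by auto
  have "x \<in> vec.span L" for x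
  proof -
    \<comment> \<open>A matrix with first column \<open>x\<close> carries \<open>x0\<close> to
      \<open>x\<close>, so the span of \<open>L\<close> contains every vector.\<close>
    have "mat2 (x$1) 0 (x$2) 0 *v x0 = x" by (simp add: x0_def axis_def quat_simps)
    then show ?thesis using all by metis
  qed
  then have L_span: "vec.span L = UNIV" by blast
  obtain n where n: "vsmall v n z" if "z \<in> (\<lambda>(s, t). b (s *v x0) (t *v x0)) ` (S \<times> S)" for z
    using finite_vsmall[of "(\<lambda>(s, t). b (s *v x0) (t *v x0)) ` (S \<times> S)"] S(1) by blast
  \<comment> \<open>The bound known on pairs of generators is extended to all of \<open>R\<close> in
    one argument at a time, with symmetry of \<open>b\<close> exchanging the arguments.\<close>
  have sub1: "o_submodule hsmul {s. \<forall>t\<in>T. vsmall v n (b (s *v x0) (t *v x0))}" for T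
    by (auto simp: o_submodule_def matrix_vector_mult_add_rdistrib hsmul_vector b_bilinear
        intro: vsmall_add vsmall_smult)
  have "R \<subseteq> {s. \<forall>t\<in>S. vsmall v n (b (s *v x0) (t *v x0))}"
    unfolding S(2) by (rule o_span_minimal[OF sub1]) (use n in auto)
  then have "vsmall v n (b (t *v x0) (s *v x0))" if "s \<in> S" "t \<in> R" for s t
    using that by blast
  then have "S \<subseteq> {s. \<forall>t\<in>R. vsmall v n (b (s *v x0) (t *v x0))}"
    by (subst b_sym) blast
  then have "R \<subseteq> {s. \<forall>t\<in>R. vsmall v n (b (s *v x0) (t *v x0))}"
    using o_span_minimal[OF sub1] S(2) by blast
  then have bounded: "vsmall v n (b x y)" if "x \<in> L" "y \<in> L" for x y
    using that by (auto simp: L_def)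
  obtain e1 e2 where e: "b e1 e2 = 0" "b e1 e1 \<noteq> 0" "b e2 e2 \<noteq> 0" "v (b e1 e1) \<le> v (b e2 e2)"
    and L_eq: "L = {r *s e1 + s *s e2 | r s. r \<in> oring v \<and> s \<in> oring v}"
    using ex_orthogonal_basis[OF L L_span bounded] by blast
  obtain P Q where fr: "orth_frame b P Q (b e1 e1) (b e2 e2)"
    and P: "\<And>x. P *v x = x$1 *s e1 + x$2 *s e2"
    using ex_orth_frame[OF e(1-3)] by blast
  have L_frame: "P *v x \<in> L" if "x$1 \<in> oring v" "x$2 \<in> oring v" for x
    using that by (auto simp: L_eq P)
  have L_coords: "(Q *v x)$1 \<in> oring v \<and> (Q *v x)$2 \<in> oring v" if x: "x \<in> L" for x
  proof -
    obtain r s where "r \<in> oring v" "s \<in> oring v" "x = P *v vector [r, s]"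
      using x by (auto simp: L_eq P)
    then show ?thesis by (simp add: frame_cancel[OF fr])
  qed
  have stable: "s *v x \<in> L" if "s \<in> R" "x \<in> L" for s x
    using that mult by (auto simp: L_def matrix_vector_mul_assoc)
  have integral: "vsmall v 0 ((Q ** s ** P)$i$j)" if s: "s \<in> R" for s i j
  proof -
    have "P *v axis j 1 \<in> L" by (intro L_frame) (auto simp: axis_def)
    from L_coords[OF stable[OF s this]]
    have "((Q ** s ** P) *v axis j 1) $ i \<in> oring v"
      using exhaust_2[of i] by (auto simp: matrix_vector_mul_assoc matrix_mul_assoc)
    then show ?thesis using exhaust_2[of j] by (auto simp: mem_oring quat_vect_nth axis_def)
  qed
  have "R \<subseteq> conj_set P Q (eichler v (v (b e2 e2) - v (b e1 e1)))"
  proof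
    fix s assume s: "s \<in> R"
    \<comment> \<open>The lower left entry of \<open>J s\<close> is \<open>u1 / u2\<close> times the
      upper right entry of \<open>s\<close>, and it is integral because \<open>J s\<close> lies in
      \<open>R\<close>.\<close>
    have "vsmall v 0 ((Q ** J s ** P)$2$1)" by (rule integral[OF J_closed[OF s]])
    then have "vsmall v 0 (b e1 e1 * (Q ** s ** P)$1$2 / b e2 e2)"
      unfolding J_frame_coords[OF fr] by (simp add: mult.commute)
    then have "vsmall v (v (b e2 e2) - v (b e1 e1)) ((Q ** s ** P)$1$2)"
      using e(2,3) by (simp add: vsmall_divide_iff vsmall_mult_iff)
    then show "s \<in> conj_set P Q (eichler v (v (b e2 e2) - v (b e1 e1)))"
      using integral[OF s] by (simp add: conj_set_def eichler_def)
  qed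
  then show thesis using that fr e(4) by blast
qed

text \<open>Rescaling basis vectors changes their norms by squares, so both valuations can be
  reduced modulo 2. The inequality between the original valuations ensures that \<open>R\<close>
  stays inside the new order.\<close>

lemma order_normalized_frame:
  assumes ord: "dagger_order v J R"
  obtains P Q u1 u2 where "orth_frame b P Q u1 u2" "v u1 \<in> {0, 1}" "v u2 - v u1 \<in> {0, 1}"
    "R \<subseteq> conj_set P Q (eichler v (v u2 - v u1))"
proof -
  obtain P Q u1 u2 where fr: "orth_frame b P Q u1 u2" and le: "v u1 \<le> v u2"
    and R: "R \<subseteq> conj_set P Q (eichler v (v u2 - v u1))"
    by (rule order_adapted_frame[OF ord])
  obtain p where p: "p \<noteq> 0" "v p = - (v u1 div 2)" by (rule ex_v_eq)
  obtain q where q: "q \<noteq> 0" "v q = - (v u2 div 2)" by (rule ex_v_eq)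
  let ?P = "P ** mat2 p 0 0 q" and ?Q = "mat2 (1/p) 0 0 (1/q) ** Q"
  let ?w1 = "u1 * p\<^sup>2" and ?w2 = "u2 * q\<^sup>2"
  have fr': "orth_frame b ?P ?Q ?w1 ?w2" by (rule orth_frame_scale[OF fr p(1) q(1)])
  have w: "v ?w1 = v u1 mod 2" "v ?w2 = v u2 mod 2"
    using u_neq_0[OF fr] p q by (simp_all add: v_mult v_square minus_mult_div_eq_mod)
  define i where "i = v u1 div 2"
  define j where "j = v u2 div 2"
  have ij: "v u1 = 2 * i + v u1 mod 2" "v u2 = 2 * j + v u2 mod 2" "i \<le> j"
    using le by (auto simp: i_def j_def zdiv_mono1)
  \<comment> \<open>The rescaling multiplies the upper right entry by \<open>q / p\<close> and the
    lower left entry by \<open>p / q\<close>, of valuations \<open>i - j\<close> and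
    \<open>j - i\<close>.\<close>
  have entries: "vsmall v 0 ((?Q ** s ** ?P)$1$1)" "vsmall v 0 ((?Q ** s ** ?P)$2$2)"
    "vsmall v (j - i + (v u2 mod 2 - v u1 mod 2)) ((?Q ** s ** ?P)$1$2)"
    "vsmall v (j - i) ((?Q ** s ** ?P)$2$1)" if s: "s \<in> R" for s
  proof -
    let ?A = "Q ** s ** P"
    have A: "?Q ** s ** ?P = mat2 (1/p) 0 0 (1/q) ** ?A ** mat2 p 0 0 q"
      by (simp add: matrix_mul_assoc)
    have "?A \<in> eichler v (v u2 - v u1)" using R s by (auto simp: conj_set_def)
    moreover have "(?Q ** s ** ?P)$1$1 = ?A$1$1" "(?Q ** s ** ?P)$2$2 = ?A$2$2"
      "(?Q ** s ** ?P)$1$2 = q * ?A$1$2 / p" "(?Q ** s ** ?P)$2$1 = p * ?A$2$1 / q"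
      unfolding A quat_mult_nth[of _ "mat2 p 0 0 q"] quat_mult_nth[of "mat2 (1/p) 0 0 (1/q)"]
      using p q by (simp_all add: field_simps)
    ultimately show "vsmall v 0 ((?Q ** s ** ?P)$1$1)" "vsmall v 0 ((?Q ** s ** ?P)$2$2)"
      "vsmall v (j - i + (v u2 mod 2 - v u1 mod 2)) ((?Q ** s ** ?P)$1$2)"
      "vsmall v (j - i) ((?Q ** s ** ?P)$2$1)"
      using p q ij(1,2)
      by (auto simp: eichler_def vsmall_divide_iff vsmall_mult_iff i_def[symmetric] j_def[symmetric]
          elim!: vsmall_mono[rotated])
  qed
  show thesis
  proof (cases "v u1 mod 2 = 1 \<and> v u2 mod 2 = 0")
    case False
    then have cases: "v u1 mod 2 = 0 \<and> v u2 mod 2 = 0 \<or> v u1 mod 2 = 0 \<and> v u2 mod 2 = 1 \<or>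
        v u1 mod 2 = 1 \<and> v u2 mod 2 = 1" by auto
    show thesis
    proof (rule that[OF fr'])
      show "v ?w1 \<in> {0, 1}" "v ?w2 - v ?w1 \<in> {0, 1}" using w cases by auto
      show "R \<subseteq> conj_set ?P ?Q (eichler v (v ?w2 - v ?w1))"
        using entries(1,2) ij(3)
        by (auto simp: conj_set_def eichler_def w
            intro: vsmall_mono[OF _ entries(3)] vsmall_mono[OF _ entries(4)])
    qed
  next
    case True
    \<comment> \<open>Here the valuations of the norms are 1 and 0 and must be swapped. Strictness
      supplies the extra factor that the new upper right entry needs, and keeps the new lower left
      entry integral.\<close>
    then have "i < j" using le ij by linarith
    show thesis
    proof (rule that[OF orth_frame_swap[OF fr']])
      show "v ?w2 \<in> {0, 1}" "v ?w1 - v ?w2 \<in> {0, 1}" using w True by auto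
      have "mat2 0 1 1 0 ** ?Q ** s ** (?P ** mat2 0 1 1 0) =
          mat2 0 1 1 0 ** (?Q ** s ** ?P) ** mat2 0 1 1 0" for s
        by (simp add: matrix_mul_assoc)
      then show "R \<subseteq> conj_set (?P ** mat2 0 1 1 0) (mat2 0 1 1 0 ** ?Q) (eichler v (v ?w1 - v ?w2))"
        using entries(1,2) True \<open>i < j\<close>
        by (auto simp: conj_set_def eichler_def w quat_mult_nth[of _ "mat2 0 1 1 0"]
            quat_mult_nth[of "mat2 0 1 1 0"]
            intro: vsmall_mono[OF _ entries(3)] vsmall_mono[OF _ entries(4)])
    qed
  qed
qed

end

section \<open>Orders of Eichler type\<close>

text \<open>Because 2 is a unit, the order \<open>eichler v (v r)\<close> has a basis which is orthogonal for the trace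
form; this makes its Gram determinant a product of four numbers.\<close>

definition eich_basis :: "'k::field \<Rightarrow> 4 \<Rightarrow> 'k quat" where
  "eich_basis r i = (if i = 1 then mat2 1 0 0 1 else if i = 2 then mat2 1 0 0 (- 1)
     else if i = 3 then mat2 0 r 1 0 else mat2 0 r (- 1) 0)"

definition eich_coord :: "'k::field \<Rightarrow> 'k quat \<Rightarrow> 4 \<Rightarrow> 'k" where
  "eich_coord r A i = (if i = 1 then (A$1$1 + A$2$2) / 2 else if i = 2 then (A$1$1 - A$2$2) / 2
     else if i = 3 then (A$1$2 / r + A$2$1) / 2 else (A$1$2 / r - A$2$1) / 2)"

text \<open>The traces of the squares of the basis elements; by orthogonality these are the diagonal
  entries of the Gram matrix.\<close>

definition eich_norm :: "'k::field \<Rightarrow> 4 \<Rightarrow> 'k" where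
  "eich_norm r i = (if i = 1 \<or> i = 2 then 2 else if i = 3 then 2 * r else - 2 * r)"

lemma distinct_4: "(2::4) \<noteq> 1" "(3::4) \<noteq> 1" "(3::4) \<noteq> 2" "(4::4) \<noteq> 1" "(4::4) \<noteq> 2" "(4::4) \<noteq> 3"
  by simp_all

lemma two_power_neq_0: "(2::'k::field) \<noteq> 0 \<Longrightarrow> (4::'k) \<noteq> 0 \<and> (8::'k) \<noteq> 0 \<and> (16::'k) \<noteq> 0"
  using power_not_zero[of "2::'k" 2] power_not_zero[of "2::'k" 3] power_not_zero[of "2::'k" 4] by simp

lemma eich_decomp:
  fixes A :: "'k::field quat"
  assumes "r \<noteq> 0" "(2::'k) \<noteq> 0"
  shows "A = (\<Sum>i\<in>UNIV. hsmul (eich_coord r A i) (eich_basis r i))"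
  using two_power_neq_0[OF assms(2)] assms by (simp add: sum_4 quat_eq_iff eich_coord_def eich_basis_def field_simps distinct_4)

lemma trace_eich:
  fixes A B :: "'k::field quat"
  assumes "r \<noteq> 0" "(2::'k) \<noteq> 0"
  shows "trace (A ** B) = (\<Sum>i\<in>UNIV. eich_coord r A i * eich_norm r i * eich_coord r B i)"
  using two_power_neq_0[OF assms(2)] assms
  by (simp add: sum_4 trace_def sum_2 quat_mult_nth eich_coord_def eich_norm_def distinct_4
    divide_simps) (simp add: algebra_simps)

lemma matrix_add_mult_rdistrib: "(A + B) ** C = A ** C + B ** (C :: 'k::comm_ring_1^'n^'m)"
  by (simp add: matrix_matrix_mult_def vec_eq_iff sum.distrib algebra_simps)

lemma trace_conj:
  fixes P :: "'k::field quat"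
  assumes "P ** Q = mat 1"
  shows "trace (Q ** A ** P) = trace A"
  by (simp add: trace_mul_sym[of "Q ** A"] matrix_mul_assoc assms)

lemma mem_conj_set: "s \<in> conj_set P Q S \<longleftrightarrow> Q ** s ** P \<in> S"
  by (simp add: conj_set_def)

section \<open>Integrality, discriminant and involution for Eichler orders\<close>

context valued_field
begin

lemma eichler_eich_coord:
  assumes "r \<noteq> 0" "(2::'k) \<noteq> 0" "v 2 = 0" "A \<in> eichler v (v r)"
  shows "eich_coord r A i \<in> oring v"
  using assms
  by (auto simp: eich_coord_def eichler_def mem_oring vsmall_divide_iff vsmall_add vsmall_diff)

lemma eich_basis_mem: "0 \<le> v r \<Longrightarrow> eich_basis r i \<in> eichler v (v r)"
  by (auto simp: eich_basis_def eichler_def vsmall_def)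

lemma o_submodule_eichler: "o_submodule hsmul (eichler v n)"
  by (auto simp: o_submodule_def eichler_def vsmall_add vsmall_smult)

lemma eichler_mult:
  assumes "A \<in> eichler v n" "B \<in> eichler v n" "0 \<le> n"
  shows "A ** B \<in> eichler v n"
proof -
  have "vsmall v 0 (A$1$2)" "vsmall v 0 (B$1$2)"
    using assms by (auto simp: eichler_def intro: vsmall_mono)
  moreover have "vsmall v n (A$1$1 * B$1$2)" "vsmall v n (A$1$2 * B$2$2)"
    using vsmall_mult[of 0 "A$1$1" n "B$1$2"] vsmall_mult[of n "A$1$2" 0 "B$2$2"] assms
    by (auto simp: eichler_def)
  ultimately show ?thesis
    using assms by (auto simp: eichler_def quat_mult_nth vsmall_add vsmall_smult mem_oring)
qed

lemma det_mem_oring: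
  fixes C :: "'k^'n^'n"
  assumes "\<And>i j. C$i$j \<in> oring v"
  shows "det C \<in> oring v"
proof -
  have prod: "(\<Prod>i\<in>I. f i) \<in> oring v" if "\<And>i. f i \<in> oring v" for f :: "'n \<Rightarrow> 'k" and I
    by (induction I rule: infinite_finite_induct) (auto simp: that oring_mult)
  have "of_int (sign p) * x \<in> oring v" if "x \<in> oring v" for p :: "'n \<Rightarrow> 'n" and x
    using that by (auto simp: sign_def mem_oring)
  then show ?thesis unfolding det_def mem_oring
    by (intro vsmall_sum) (simp add: prod assms flip: mem_oring)
qed

end

context adjoint_form_space
begin

text \<open>The Gram matrix of four elements is \<open>C ** D ** transpose C\<close>, with
  \<open>C\<close> their integral coordinate matrix and \<open>D\<close> the diagonal Gram matrix of
  the basis. So every generator is \<open>det D\<close> times an integral square, and the basis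
  itself attains \<open>det D\<close>.\<close>

lemma disc_ideal_conj_eichler:
  assumes PQ: "P ** Q = mat 1" and n: "0 \<le> n"
  shows "disc_ideal v (conj_set P Q (eichler v n)) = pideal (2 * n)"
proof -
  have QP: "Q ** P = mat 1" using PQ matrix_left_right_inverse by blast
  obtain r where r: "r \<noteq> 0" "v r = n" by (rule ex_v_eq)
  let ?R = "conj_set P Q (eichler v n)"
  define c where "c x = (\<chi> (i::4) k. eich_coord r (Q ** x i ** P) k)" for x :: "4 \<Rightarrow> 'k quat"
  define d where "d = det (\<chi> i k. if i = k then eich_norm r i else 0)"
  \<comment> \<open>The four norms multiply to -16 times the square of \<open>r\<close>; as 2 is a
    unit, the valuation is \<open>2 * n\<close>.\<close>
  have d: "d = (4 * r)\<^sup>2 * (- 1)"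
  proof -
    have "d = (\<Prod>i\<in>UNIV. eich_norm r i)" unfolding d_def by (subst det_diagonal) simp_all
    also have "\<dots> = 2 * 2 * (2 * r) * (- 2 * r)"
      unfolding UNIV_4 by (simp add: eich_norm_def distinct_4)
    finally show ?thesis by (simp add: power2_eq_square)
  qed
  have four: "(4::'k) \<noteq> 0 \<and> v 4 = 0"
    using v_mult[of 2 2] two_power_neq_0[OF two_neq_0] by simp
  have v_d: "d \<noteq> 0" "v d = 2 * n"
    unfolding d using v_square[of "4 * r"] v_mult[of 4 r] r four two_power_neq_0[OF two_neq_0]
    by simp_all
  have gram: "det (\<chi> i j. trace (x i ** x j)) = det (c x) * d * det (c x)" for x
  proof -
    have "trace (x i ** x j) = (\<Sum>k\<in>UNIV. c x $ i $ k * eich_norm r k * c x $ j $ k)" for i j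
    proof -
      have "trace (x i ** x j) = trace (Q ** (x i ** x j) ** P)"
        by (rule trace_conj[OF PQ, symmetric])
      also have "Q ** (x i ** x j) ** P = (Q ** x i ** P) ** (Q ** x j ** P)"
        by (simp add: invertible_pair_cancel[OF PQ] flip: matrix_mul_assoc)
      finally show ?thesis by (simp add: c_def trace_eich[OF r(1) two_neq_0])
    qed
    then have "(\<chi> i j. trace (x i ** x j)) =
        c x ** (\<chi> i k. if i = k then eich_norm r i else 0) ** transpose (c x)"
      by (simp add: vec_eq_iff matrix_matrix_mult_def transpose_def if_distrib cong: if_cong)
    then show ?thesis by (simp add: det_mul d_def)
  qed
  show ?thesis unfolding disc_ideal_def
  proof (rule o_span_eq_pideal)
    show "{det (\<chi> (i::4) (j::4). trace (x i ** x j)) |x. \<forall>i. x i \<in> ?R} \<subseteq> pideal (2 * n)"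
    proof clarify
      fix x :: "4 \<Rightarrow> 'k quat" assume x: "\<forall>i. x i \<in> ?R"
      have "det (c x) \<in> oring v"
        using x r by (intro det_mem_oring) (auto simp: c_def mem_conj_set intro!: eichler_eich_coord)
      then have "vsmall v (0 + (2 * n) + 0) (det (c x) * d * det (c x))"
        using v_d by (intro vsmall_mult) (auto simp: mem_oring vsmall_def)
      then show "det (\<chi> i j. trace (x i ** x j)) \<in> pideal (2 * n)"
        by (simp add: gram pideal_def)
    qed
    define x where "x i = P ** eich_basis r i ** Q" for i
    have Qx: "Q ** x i ** P = eich_basis r i" for i
      by (simp add: x_def invertible_pair_cancel[OF QP] QP flip: matrix_mul_assoc)
    have "eich_coord r (eich_basis r i) k = (if i = k then 1 else 0)" for i k
      using r exhaust_4[of i] exhaust_4[of k]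
      by (auto simp: eich_coord_def eich_basis_def distinct_4)
    then have "c x = mat 1" by (simp add: c_def Qx mat_def vec_eq_iff)
    then have "d = det (\<chi> i j. trace (x i ** x j))" by (simp add: gram)
    moreover have "\<forall>i. x i \<in> ?R" using eich_basis_mem[of r] r n by (auto simp: mem_conj_set Qx)
    ultimately show "d \<in> {det (\<chi> (i::4) (j::4). trace (x i ** x j)) |x. \<forall>i. x i \<in> ?R}" by blast
  qed (use v_d in auto)
qed

text \<open>The transported basis shows that this is a lattice. It is stable under \<open>J\<close>
  because \<open>J\<close> interchanges the off-diagonal entries up to \<open>u2 / u1\<close>, whose
  valuation is exactly the exponent of the order.\<close>

lemma dagger_order_conj_eichler:
  assumes fr: "orth_frame b P Q u1 u2" and le: "v u1 \<le> v u2"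
  shows "dagger_order v J (conj_set P Q (eichler v (v u2 - v u1)))"
proof -
  let ?n = "v u2 - v u1"
  let ?R = "conj_set P Q (eichler v ?n)"
  note PQ = PQ[OF fr] and QP = QP[OF fr] and cancel = frame_cancel[OF fr]
  obtain r where r: "r \<noteq> 0" "v r = ?n" by (rule ex_v_eq)
  have decomp: "s = (\<Sum>i\<in>UNIV. hsmul (eich_coord r (Q ** s ** P) i) (P ** eich_basis r i ** Q))" for s
  proof -
    have "s = P ** (Q ** s ** P) ** Q" by (simp add: frame_coords[OF fr])
    also have "\<dots> = P ** (\<Sum>i\<in>UNIV. hsmul (eich_coord r (Q ** s ** P) i) (eich_basis r i)) ** Q"
      by (rule arg_cong[OF eich_decomp[OF r(1) two_neq_0], where f = "\<lambda>A. P ** A ** Q"])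
    also have "\<dots> = (\<Sum>i\<in>UNIV. hsmul (eich_coord r (Q ** s ** P) i) (P ** eich_basis r i ** Q))"
      by (simp add: sum_4 matrix_add_ldistrib matrix_add_mult_rdistrib hsmul_mult_left hsmul_mult_right)
    finally show ?thesis .
  qed
  have sub: "o_submodule hsmul ?R"
    using o_submodule_eichler[of ?n]
    by (simp add: o_submodule_def mem_conj_set matrix_add_ldistrib matrix_add_mult_rdistrib
        hsmul_mult_left hsmul_mult_right)
  have gen: "P ** eich_basis r i ** Q \<in> ?R" for i
    using eich_basis_mem[of r i] r le by (simp add: mem_conj_set frame_coords[OF fr])
  have "?R = o_span v hsmul (range (\<lambda>i. P ** eich_basis r i ** Q))" (is "_ = ?S")
  proof
    show "?S \<subseteq> ?R" using gen by (intro o_span_minimal[OF sub]) auto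
    note S = o_submodule_o_span[OF hs.vector_space_axioms, of "range (\<lambda>i. P ** eich_basis r i ** Q)"]
    show "?R \<subseteq> ?S"
    proof
      fix s assume "s \<in> ?R"
      then have "eich_coord r (Q ** s ** P) i \<in> oring v" for i
        using r by (intro eichler_eich_coord) (auto simp: mem_conj_set)
      then have "hsmul (eich_coord r (Q ** s ** P) i) (P ** eich_basis r i ** Q) \<in> ?S" for i
        using S o_span_base[OF hs.vector_space_axioms, of "P ** eich_basis r i ** Q"]
        by (auto simp: o_submodule_def)
      then show "s \<in> ?S"
        by (subst decomp[of s]) (use S in \<open>simp add: sum_4 o_submodule_def\<close>)
    qed
  qed
  moreover have "hs.span ?R = UNIV"
  proof -
    have "s \<in> hs.span ?R" for s
      by (subst decomp[of s]) (intro hs.span_sum hs.span_scale hs.span_base gen)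
    then show ?thesis by blast
  qed
  ultimately have "o_lattice v hsmul ?R" unfolding o_lattice_def
    by (intro conjI exI[of _ "range (\<lambda>i. P ** eich_basis r i ** Q)"]) simp_all
  moreover have "mat 1 \<in> ?R" using le by (simp add: mem_conj_set QP eichler_def mat_1_nth vsmall_def)
  moreover have "A ** B \<in> ?R" if "A \<in> ?R" "B \<in> ?R" for A B
  proof -
    have "Q ** (A ** B) ** P = (Q ** A ** P) ** (Q ** B ** P)"
      by (simp add: cancel flip: matrix_mul_assoc)
    then show ?thesis using that eichler_mult[of _ ?n] le by (simp add: mem_conj_set)
  qed
  moreover have J: "J s \<in> ?R" if "s \<in> ?R" for s
    using that u_neq_0[OF fr]
    unfolding mem_conj_set J_frame_coords[OF fr]
    by (auto simp: eichler_def vsmall_divide_iff vsmall_mult_iff mult.commute[of _ u1] mult.commute[of _ u2])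
  moreover have "J ` ?R = ?R"
  proof
    show "J ` ?R \<subseteq> ?R" using J by blast
    show "?R \<subseteq> J ` ?R"
    proof
      fix s assume "s \<in> ?R"
      then show "s \<in> J ` ?R" using J J_J[of s] by (intro image_eqI[of s J "J s"]) simp_all
    qed
  qed
  ultimately show ?thesis by (simp add: dagger_order_def quat_order_def)
qed

text \<open>The order containing \<open>R\<close> is itself stable under \<open>J\<close>, so
  maximality turns the inclusion into equality.\<close>

lemma max_order_frame:
  assumes "max_dagger_order v J R"
  obtains P Q u1 u2 where "orth_frame b P Q u1 u2" "v u1 \<in> {0, 1}" "v u2 - v u1 \<in> {0, 1}"
    "R = conj_set P Q (eichler v (v u2 - v u1))"
proof -
  have "dagger_order v J R" using assms by (simp add: max_dagger_order_def)
  then obtain P Q u1 u2 where fr: "orth_frame b P Q u1 u2" "v u1 \<in> {0, 1}" "v u2 - v u1 \<in> {0, 1}"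
    and "R \<subseteq> conj_set P Q (eichler v (v u2 - v u1))" by (rule order_normalized_frame)
  moreover have "dagger_order v J (conj_set P Q (eichler v (v u2 - v u1)))"
    using fr by (intro dagger_order_conj_eichler) auto
  ultimately show thesis using that assms unfolding max_dagger_order_def by blast
qed

end

section \<open>Lattices, isomorphisms and discriminants\<close>

context adjoint_form_space
begin

definition frame_lattice :: "'k quat \<Rightarrow> int \<Rightarrow> int \<Rightarrow> 'k vect set" where
  "frame_lattice Q m n = {y. vsmall v m ((Q *v y)$1) \<and> vsmall v n ((Q *v y)$2)}"

text \<open>Stability of the first lattice means integral entries. Stability of the second puts the
  upper right entry at level \<open>n - m\<close> and the lower left at level \<open>m - n\<close>,
  the latter being implied by integrality since \<open>m\<close> \<le> \<open>n\<close>.\<close>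

lemma End_frame_lattices:
  assumes PQ: "P ** Q = mat 1" and mn: "m \<le> n"
  shows "End_lat (frame_lattice Q 0 0) \<inter> End_lat (frame_lattice Q (- m) (- n)) =
    conj_set P Q (eichler v (n - m))"
proof (intro equalityI subsetI)
  have QP: "Q ** P = mat 1" using PQ matrix_left_right_inverse by blast
  fix s assume s: "s \<in> End_lat (frame_lattice Q 0 0) \<inter> End_lat (frame_lattice Q (- m) (- n))"
  have act: "(Q ** s ** P) *v x = Q *v (s *v (P *v x))" for x
    by (simp add: matrix_vector_mul_assoc matrix_mul_assoc)
  have coords: "Q *v (P *v x) = x" for x by (simp add: matrix_vector_mul_assoc QP)
  have "vsmall v 0 ((Q ** s ** P)$i$j)" for i j
  proof -
    have "P *v axis j 1 \<in> frame_lattice Q 0 0" by (simp add: frame_lattice_def coords axis_def vsmall_def)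
    then have "s *v (P *v axis j 1) \<in> frame_lattice Q 0 0" using s by (auto simp: End_lat_def)
    then have "vsmall v 0 (((Q ** s ** P) *v axis j 1)$i)"
      using exhaust_2[of i] unfolding act by (auto simp: frame_lattice_def)
    then show ?thesis using exhaust_2[of j] by (auto simp: quat_vect_nth axis_def)
  qed
  moreover have "vsmall v (n - m) ((Q ** s ** P)$1$2)"
  proof -
    \<comment> \<open>The multiple of the second basis vector by \<open>r\<close> generates that
      part of the second lattice, so its image tests the upper right entry sharply.\<close>
    obtain r where r: "r \<noteq> 0" "v r = - n" by (rule ex_v_eq)
    have "P *v axis 2 r \<in> frame_lattice Q (- m) (- n)"
      using r by (simp add: frame_lattice_def coords axis_def vsmall_def)
    then have "s *v (P *v axis 2 r) \<in> frame_lattice Q (- m) (- n)" using s by (auto simp: End_lat_def)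
    then have "vsmall v (- m) (((Q ** s ** P) *v axis 2 r)$1)"
      unfolding act by (simp add: frame_lattice_def)
    then show ?thesis
      using r by (simp add: quat_vect_nth axis_def mult.commute[of _ r] vsmall_mult_iff)
  qed
  ultimately show "s \<in> conj_set P Q (eichler v (n - m))" by (simp add: mem_conj_set eichler_def)
next
  fix s assume "s \<in> conj_set P Q (eichler v (n - m))"
  then have A: "vsmall v 0 ((Q ** s ** P)$1$1)" "vsmall v (n - m) ((Q ** s ** P)$1$2)"
    "vsmall v 0 ((Q ** s ** P)$2$1)" "vsmall v 0 ((Q ** s ** P)$2$2)"
    by (auto simp: mem_conj_set eichler_def)
  have A12: "vsmall v 0 ((Q ** s ** P)$1$2)" using vsmall_mono[OF _ A(2)] mn by simp
  have act: "Q *v (s *v y) = (Q ** s ** P) *v (Q *v y)" for y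
    by (simp add: matrix_vector_mul_assoc invertible_pair_cancel[OF PQ] PQ flip: matrix_mul_assoc)
  note nth = quat_vect_nth[of "Q ** s ** P" "Q *v y" for y]
  have "s *v y \<in> frame_lattice Q 0 0" if "y \<in> frame_lattice Q 0 0" for y
    using that A A12 by (simp add: frame_lattice_def act nth vsmall_add vsmall_smult mem_oring)
  moreover have "s *v y \<in> frame_lattice Q (- m) (- n)" if "y \<in> frame_lattice Q (- m) (- n)" for y
  proof -
    have y: "vsmall v (- m) ((Q *v y)$1)" "vsmall v (- n) ((Q *v y)$2)"
      using that by (auto simp: frame_lattice_def)
    have "vsmall v (- n) ((Q *v y)$1)" using vsmall_mono[OF _ y(1)] mn by simp
    moreover have "vsmall v (- m) ((Q ** s ** P)$1$2 * (Q *v y)$2)"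
      using vsmall_mult[OF A(2) y(2)] by simp
    ultimately show ?thesis
      using y A by (simp add: frame_lattice_def act nth vsmall_add vsmall_smult mem_oring)
  qed
  ultimately show "s \<in> End_lat (frame_lattice Q 0 0) \<inter> End_lat (frame_lattice Q (- m) (- n))"
    by (simp add: End_lat_def)
qed

context
  fixes P Q u1 u2
  assumes fr: "orth_frame b P Q u1 u2"
begin

lemma b_frame_coords: "b x y = u1 * (Q *v x)$1 * (Q *v y)$1 + u2 * (Q *v x)$2 * (Q *v y)$2"
  using frame_form[OF fr, of "Q *v x" "Q *v y"] by (simp add: frame_cancel[OF fr])

text \<open>Orthogonality separates the coordinates, and duality inverts each norm.\<close>

lemma dual_frame_lattice:
  "dual_lattice v b (frame_lattice Q 0 0) = frame_lattice Q (- v u1) (- v u2)"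
proof (intro equalityI subsetI)
  fix x assume x: "x \<in> dual_lattice v b (frame_lattice Q 0 0)"
  have "P *v axis j 1 \<in> frame_lattice Q 0 0" for j
    by (simp add: frame_lattice_def frame_cancel[OF fr] axis_def vsmall_def)
  then have *: "b x (P *v axis j 1) \<in> oring v" for j using x by (auto simp: dual_lattice_def)
  show "x \<in> frame_lattice Q (- v u1) (- v u2)"
    using *[of 1] *[of 2] u_neq_0[OF fr]
    by (simp add: frame_lattice_def b_frame_coords frame_cancel[OF fr] axis_def mem_oring vsmall_mult_iff)
next
  fix x assume x: "x \<in> frame_lattice Q (- v u1) (- v u2)"
  have "b x y \<in> oring v" if "y \<in> frame_lattice Q 0 0" for y
  proof -
    have "vsmall v (v u1 + (- v u1) + 0) (u1 * (Q *v x)$1 * (Q *v y)$1)"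
      "vsmall v (v u2 + (- v u2) + 0) (u2 * (Q *v x)$2 * (Q *v y)$2)"
      using x that by (intro vsmall_mult; simp add: frame_lattice_def)+
    then show ?thesis by (simp add: b_frame_coords mem_oring vsmall_add)
  qed
  then show "x \<in> dual_lattice v b (frame_lattice Q 0 0)" by (simp add: dual_lattice_def)
qed

lemma frame_decomp: "y = (Q *v y)$1 *s (P *v axis 1 1) + (Q *v y)$2 *s (P *v axis 2 1)"
proof -
  have "(Q *v y)$1 *s axis 1 1 + (Q *v y)$2 *s axis 2 1 = Q *v y"
    by (simp add: vect_eq_iff axis_def)
  then have "P *v ((Q *v y)$1 *s axis 1 1 + (Q *v y)$2 *s axis 2 1) = y"
    by (simp add: frame_cancel[OF fr])
  then show ?thesis by (simp add: vec.add vec.scale)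
qed

lemma vlattice_frame: "vlattice v (frame_lattice Q 0 0)"
proof -
  let ?L = "frame_lattice Q 0 0" and ?B = "{P *v axis 1 1, P *v axis 2 1}"
  have sub: "o_submodule (*s) ?L"
    by (auto simp: o_submodule_def frame_lattice_def vec.add vec.scale intro: vsmall_add vsmall_smult)
  have B: "?B \<subseteq> ?L" by (auto simp: frame_lattice_def frame_cancel[OF fr] axis_def vsmall_def)
  note S = o_submodule_o_span[OF vec.vector_space_axioms, of ?B]
  have "?L \<subseteq> o_span v (*s) ?B"
  proof
    fix y assume "y \<in> ?L"
    then have "(Q *v y)$1 *s (P *v axis 1 1) + (Q *v y)$2 *s (P *v axis 2 1) \<in> o_span v (*s) ?B"
      using S o_span_base[OF vec.vector_space_axioms, of _ ?B]
      by (simp add: o_submodule_def frame_lattice_def mem_oring)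
    then show "y \<in> o_span v (*s) ?B" using frame_decomp[of y] by simp
  qed
  with o_span_minimal[OF sub B] have "?L = o_span v (*s) ?B" by blast
  moreover have "vec.span ?L = UNIV"
  proof -
    have "(Q *v y)$1 *s (P *v axis 1 1) + (Q *v y)$2 *s (P *v axis 2 1) \<in> vec.span ?L" for y
      using B by (intro vec.span_add vec.span_scale vec.span_base) auto
    then show ?thesis using frame_decomp by (metis UNIV_eq_I)
  qed
  ultimately show ?thesis unfolding vlattice_def o_lattice_def
    by (intro conjI exI[of _ ?B]) simp_all
qed

text \<open>In a larger lattice within the norm bound, polarization against the first basis vector
  makes the first coordinate integral. The norm then bounds \<open>u2\<close> times the square of
  the second coordinate. Since \<open>v u2\<close> exceeds \<open>v u1\<close> by at most 1, parity
  excludes a negative valuation there.\<close>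

lemma a_maximal_frame:
  assumes u: "v u1 \<le> v u2" "v u2 \<le> v u1 + 1"
  shows "a_maximal v b (pideal (v u1)) (frame_lattice Q 0 0)"
  unfolding a_maximal_def
proof (intro conjI notI)
  show "vlattice v (frame_lattice Q 0 0)" by (rule vlattice_frame)
  show "norm_ideal v b (frame_lattice Q 0 0) \<subseteq> pideal (v u1)"
    unfolding norm_ideal_def
  proof (rule o_span_minimal[OF o_submodule_pideal], clarify)
    fix x assume "x \<in> frame_lattice Q 0 0"
    then have "vsmall v (v u1 + 0 + 0) (u1 * (Q *v x)$1 * (Q *v x)$1)"
      "vsmall v (v u1 + 0 + 0) (u2 * (Q *v x)$2 * (Q *v x)$2)"
      using u by (intro vsmall_mult; simp add: frame_lattice_def vsmall_def[of v _ u2])+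
    then show "b x x \<in> pideal (v u1)" by (simp add: pideal_def b_frame_coords vsmall_add)
  qed
next
  assume "\<exists>L'. vlattice v L' \<and> frame_lattice Q 0 0 \<subset> L' \<and> norm_ideal v b L' \<subseteq> pideal (v u1)"
  then obtain L' where L': "vlattice v L'" "frame_lattice Q 0 0 \<subset> L'" "norm_ideal v b L' \<subseteq> pideal (v u1)"
    by blast
  have add: "x + y \<in> L'" if "x \<in> L'" "y \<in> L'" for x y
    using o_lattice_submodule[OF vec.vector_space_axioms] L'(1) that
    by (auto simp: vlattice_def o_submodule_def)
  have q: "vsmall v (v u1) (b x x)" if "x \<in> L'" for x
  proof -
    have "b x x \<in> norm_ideal v b L'" unfolding norm_ideal_def
      by (rule o_span_base[OF vector_space_over_itself.vector_space_axioms]) (rule imageI[OF that])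
    then show ?thesis using L'(3) by (auto simp: pideal_def)
  qed
  have "L' \<subseteq> frame_lattice Q 0 0"
  proof
    fix x assume x: "x \<in> L'"
    have "P *v axis 1 1 \<in> frame_lattice Q 0 0"
      by (simp add: frame_lattice_def frame_cancel[OF fr] axis_def vsmall_def)
    then have e: "P *v axis 1 1 \<in> L'"
      by (rule subsetD[OF psubset_imp_subset[OF L'(2)]])
    have "vsmall v (v u1) (b x (P *v axis 1 1))"
      by (rule vsmall_polarize[OF q q q]) (rule add x e)+
    then have x1: "vsmall v 0 ((Q *v x)$1)"
      using u_neq_0[OF fr] by (simp add: b_frame_coords frame_cancel[OF fr] axis_def vsmall_mult_iff)
    have "vsmall v (v u1 + 0 + 0) (u1 * (Q *v x)$1 * (Q *v x)$1)"
      using x1 by (intro vsmall_mult) auto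
    then have "vsmall v (v u1) (b x x - u1 * (Q *v x)$1 * (Q *v x)$1)"
      using q[OF x] by (simp add: vsmall_diff)
    then have "vsmall v (v u1) (u2 * ((Q *v x)$2)\<^sup>2)"
      by (simp add: b_frame_coords power2_eq_square mult.assoc)
    then have "vsmall v 0 ((Q *v x)$2)"
      using u u_neq_0[OF fr] by (cases "(Q *v x)$2 = 0") (auto simp: vsmall_def v_mult v_square)
    with x1 show "x \<in> frame_lattice Q 0 0" by (simp add: frame_lattice_def)
  qed
  then show False using L'(2) by blast
qed

text \<open>In coordinates a skew element has zero diagonal, and its upper right entry is
  \<open>- u2 / u1\<close> times its lower left entry \<open>s\<close>; the determinant
  follows.\<close>

lemma disc_inv_class_frame: "disc_inv_class J = {s\<^sup>2 * (u2 / u1) | s. s \<noteq> 0}"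
proof (intro equalityI subsetI)
  have det: "det (Q ** h ** P) = det h" for h
  proof -
    have "det Q * det P = 1" using QP[OF fr] by (metis det_I det_mul)
    then show ?thesis by (simp add: det_mul mult.assoc mult.left_commute)
  qed
  {
    fix x assume "x \<in> disc_inv_class J"
    then obtain h where h: "h \<noteq> 0" "J h = - h" "x = det h" by (auto simp: disc_inv_class_def)
    define A where "A = Q ** h ** P"
    have "Q ** J h ** P = - A"
      unfolding h(2) A_def by (simp add: quat_simps algebra_simps)
    then have A: "A$1$1 = - A$1$1" "A$2$2 = - A$2$2" "A$1$2 = - (A$2$1 * u2 / u1)"
      unfolding J_frame_coords[OF fr] A_def[symmetric] by (simp_all add: quat_eq_iff)
    have zero: "z = - z \<Longrightarrow> z = 0" for z :: 'k
      using two_neq_0 by (metis add.right_inverse mult_2 mult_eq_0_iff)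
    have "A$1$1 = 0" "A$2$2 = 0" using A zero by blast+
    moreover have "A \<noteq> 0"
    proof
      assume "A = 0"
      then have "h = P ** 0 ** Q" using frame_coords(2)[OF fr, of h] by (simp add: A_def)
      then show False using h(1) by (simp add: quat_simps)
    qed
    ultimately have "A$2$1 \<noteq> 0" using A(3) by (auto simp: quat_eq_iff)
    moreover have "det A = (A$2$1)\<^sup>2 * (u2 / u1)"
      unfolding det_2 A(3) \<open>A$1$1 = 0\<close> by (simp add: power2_eq_square)
    then have "x = (A$2$1)\<^sup>2 * (u2 / u1)" using det[of h] h(3) by (simp only: A_def)
    ultimately show "x \<in> {s\<^sup>2 * (u2 / u1) | s. s \<noteq> 0}" by blast
  next
    fix x assume "x \<in> {s\<^sup>2 * (u2 / u1) | s. s \<noteq> 0}"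
    then obtain s where s: "s \<noteq> 0" "x = s\<^sup>2 * (u2 / u1)" by blast
    define A where "A = mat2 0 (- (s * u2 / u1)) s 0"
    define h where "h = P ** A ** Q"
    have hA: "Q ** h ** P = A" by (simp add: h_def frame_coords[OF fr])
    have "J h = P ** (- A) ** Q"
      unfolding h_def J_frame[OF fr] using u_neq_0[OF fr]
      by (intro arg_cong[where f = "\<lambda>A. P ** A ** Q"]) (simp add: A_def quat_eq_iff)
    also have "\<dots> = - h" by (simp add: h_def quat_simps algebra_simps)
    finally have "J h = - h" .
    moreover have "h \<noteq> 0"
    proof
      assume "h = 0"
      then have "A$2$1 = 0" unfolding hA[symmetric] by (simp add: quat_mult_nth)
      then show False using s by (simp add: A_def)
    qed
    moreover have "det h = x"
      unfolding det[of h, symmetric] hA s(2) by (simp add: A_def det_2 power2_eq_square)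
    ultimately show "x \<in> disc_inv_class J" unfolding disc_inv_class_def by blast
  }
qed

text \<open>All valuations in the square class have the parity of \<open>v u2 - v u1\<close>, which
  is 0 or 1 and therefore the least nonnegative one.\<close>

lemma iota_disc_frame:
  assumes "v u2 - v u1 \<in> {0, 1}"
  shows "iota v (disc_inv_class J) = pideal (v u2 - v u1)"
  unfolding iota_def
proof (rule o_span_eq_pideal)
  show "disc_inv_class J \<inter> oring v \<subseteq> pideal (v u2 - v u1)"
  proof
    fix x assume "x \<in> disc_inv_class J \<inter> oring v"
    then obtain s where s: "s \<noteq> 0" "x = s\<^sup>2 * (u2 / u1)" and x: "x \<in> oring v"
      by (auto simp: disc_inv_class_frame)
    then have v_x: "v x = 2 * v s + (v u2 - v u1)"
      using u_neq_0[OF fr] by (simp add: v_mult v_divide v_square)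
    have "x \<noteq> 0" using s u_neq_0[OF fr] by simp
    then have "0 \<le> v x" using x by (simp add: oring_def)
    then have "0 \<le> v s" using v_x assms by auto
    then show "x \<in> pideal (v u2 - v u1)" using v_x by (simp add: pideal_def vsmall_def)
  qed
  show "u2 / u1 \<in> disc_inv_class J \<inter> oring v"
    using assms u_neq_0[OF fr]
    by (auto simp: disc_inv_class_frame oring_def v_divide intro: exI[of _ 1])
qed (use u_neq_0[OF fr] in \<open>auto simp: v_divide\<close>)

end

lemma reduced_disc_max_order:
  assumes "max_dagger_order v J R"
  shows "reduced_disc v R = disc_H_split v \<inter> iota v (disc_inv_class J)"
proof -
  obtain P Q u1 u2 where fr: "orth_frame b P Q u1 u2" and n: "v u2 - v u1 \<in> {0, 1}"
    and R: "R = conj_set P Q (eichler v (v u2 - v u1))" by (rule max_order_frame[OF assms])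
  have "reduced_disc v R = pideal (v u2 - v u1)"
    using n PQ[OF fr] unfolding R by (intro reduced_disc_eq_pideal disc_ideal_conj_eichler) auto
  moreover have "pideal (v u2 - v u1) \<subseteq> oring v"
    using n unfolding pideal_0[symmetric] pideal_subset_iff by auto
  ultimately show ?thesis
    unfolding disc_H_split_def iota_disc_frame[OF fr n] by blast
qed

lemma max_order_eq_End:
  assumes "max_dagger_order v J R"
  shows "\<exists>a L. frac_ideal v a \<and> a \<subseteq> oring v \<and> a_maximal v b a L \<and>
    R = End_lat L \<inter> End_lat (dual_lattice v b L)"
proof -
  obtain P Q u1 u2 where fr: "orth_frame b P Q u1 u2" and u: "v u1 \<in> {0, 1}" "v u2 - v u1 \<in> {0, 1}"
    and R: "R = conj_set P Q (eichler v (v u2 - v u1))" by (rule max_order_frame[OF assms])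
  show ?thesis
  proof (intro exI conjI)
    \<comment> \<open>The ideal is generated by the norm of the first basis vector, and the lattice
      is spanned by the frame.\<close>
    show "frac_ideal v (pideal (v u1))" by (auto simp: frac_ideal_iff)
    show "pideal (v u1) \<subseteq> oring v" using u(1) unfolding pideal_0[symmetric] pideal_subset_iff by auto
    show "a_maximal v b (pideal (v u1)) (frame_lattice Q 0 0)"
      using u(2) by (intro a_maximal_frame[OF fr]) auto
    show "R = End_lat (frame_lattice Q 0 0) \<inter> End_lat (dual_lattice v b (frame_lattice Q 0 0))"
      using u(2) unfolding R dual_frame_lattice[OF fr]
      by (subst End_frame_lattices[OF PQ[OF fr]]) auto
  qed
qed

text \<open>The map is conjugation by \<open>P' ** Q\<close>, which carries one frame to the other.
  Equal ratios make it a similitude, and \<open>J\<close> has the same coordinate formula in both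
  frames.\<close>

lemma auto_inv_frames:
  assumes fr: "orth_frame b P Q u1 u2" and fr': "orth_frame b P' Q' w1 w2"
    and ratio: "w2 / w1 = u2 / u1"
  shows "auto_inv J (\<lambda>s. P' ** (Q ** s ** P) ** Q')"
    "(\<lambda>s. P' ** (Q ** s ** P) ** Q') ` conj_set P Q S = conj_set P' Q' S"
proof -
  let ?\<phi> = "\<lambda>s. P' ** (Q ** s ** P) ** Q'" and ?\<psi> = "\<lambda>s. P ** (Q' ** s ** P') ** Q"
  have inv: "?\<psi> (?\<phi> s) = s" "?\<phi> (?\<psi> s) = s" for s
    by (simp_all only: frame_coords[OF fr] frame_coords[OF fr'])
  have "bij ?\<phi>" by (rule o_bij[of ?\<psi>]) (simp_all only: fun_eq_iff comp_def id_def inv, simp_all)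
  moreover have "?\<phi> (A ** B) = ?\<phi> A ** ?\<phi> B" for A B
    by (simp add: frame_cancel[OF fr] frame_cancel[OF fr'] flip: matrix_mul_assoc)
  moreover have "?\<phi> (mat 1) = mat 1" by (simp add: QP[OF fr] PQ[OF fr'])
  moreover have "?\<phi> (J s) = J (?\<phi> s)" for s
  proof -
    have "w1 / w2 = u1 / u2" using arg_cong[OF ratio, of inverse] by simp
    then have "x * w1 / w2 = x * u1 / u2" "x * w2 / w1 = x * u2 / u1" for x
      using ratio by (metis times_divide_eq_right)+
    then show ?thesis by (simp only: J_frame[OF fr'] J_frame_coords[OF fr])
  qed
  ultimately show "auto_inv J ?\<phi>"
    by (simp add: auto_inv_def matrix_add_ldistrib matrix_add_mult_rdistrib hsmul_mult_left hsmul_mult_right)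
  show "?\<phi> ` conj_set P Q S = conj_set P' Q' S"
  proof (intro equalityI subsetI)
    fix s assume s: "s \<in> conj_set P' Q' S"
    show "s \<in> ?\<phi> ` conj_set P Q S"
    proof (rule image_eqI)
      show "s = ?\<phi> (?\<psi> s)" by (simp only: inv)
      show "?\<psi> s \<in> conj_set P Q S"
        using s by (simp only: mem_conj_set frame_coords[OF fr])
    qed
  qed (auto simp: mem_conj_set frame_coords[OF fr'])
qed

text \<open>Conjugation by a diagonal matrix with unit entries multiplies the matrix entries by
  units, so it preserves the order.\<close>

lemma conj_set_eichler_scale:
  assumes t: "t \<noteq> 0" "v t = 0"
  shows "conj_set (P ** mat2 1 0 0 t) (mat2 1 0 0 (1 / t) ** Q) (eichler v n) = conj_set P Q (eichler v n)"
proof -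
  have "mat2 1 0 0 (1 / t) ** Q ** s ** (P ** mat2 1 0 0 t) =
      mat2 1 0 0 (1 / t) ** (Q ** s ** P) ** mat2 1 0 0 t" for s
    by (simp add: matrix_mul_assoc)
  then show ?thesis
    using t by (auto simp: conj_set_def eichler_def quat_mult_nth[of _ "mat2 1 0 0 t"]
        quat_mult_nth[of "mat2 1 0 0 (1 / t)"] mult.commute[of _ t] vsmall_mult_iff vsmall_divide_iff)
qed

text \<open>A change of basis multiplies the Gram determinant by the square of its
  determinant.\<close>

lemma frame_gram_det:
  assumes fr: "orth_frame b P Q u1 u2" and fr': "orth_frame b P' Q' w1 w2"
  obtains d where "d \<noteq> 0" "w1 * w2 = u1 * u2 * d\<^sup>2"
proof -
  define R where "R = Q ** P'"
  have R: "b (P' *v x) (P' *v y) = u1 * (R *v x)$1 * (R *v y)$1 + u2 * (R *v x)$2 * (R *v y)$2" for x y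
    by (simp add: b_frame_coords[OF fr] R_def matrix_vector_mul_assoc)
  note form = R[unfolded frame_form[OF fr']]
  have w: "w1 = u1 * (R$1$1)\<^sup>2 + u2 * (R$2$1)\<^sup>2" "w2 = u1 * (R$1$2)\<^sup>2 + u2 * (R$2$2)\<^sup>2"
    "0 = u1 * R$1$1 * R$1$2 + u2 * R$2$1 * R$2$2"
    using form[of "axis 1 1" "axis 1 1"] form[of "axis 2 1" "axis 2 1"] form[of "axis 1 1" "axis 2 1"]
    by (simp_all add: quat_vect_nth axis_def power2_eq_square mult.assoc)
  \<comment> \<open>Subtracting the square of the vanishing inner product completes the Gram
    determinant, and a Lagrange-type identity factors it.\<close>
  have "w1 * w2 = w1 * w2 - (u1 * R$1$1 * R$1$2 + u2 * R$2$1 * R$2$2)\<^sup>2"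
    unfolding w(3)[symmetric] by simp
  also have "\<dots> = u1 * u2 * (R$1$1 * R$2$2 - R$1$2 * R$2$1)\<^sup>2"
    unfolding w(1,2) by (simp add: power2_eq_square algebra_simps)
  finally have "w1 * w2 = u1 * u2 * (R$1$1 * R$2$2 - R$1$2 * R$2$1)\<^sup>2" .
  moreover from this have "R$1$1 * R$2$2 - R$1$2 * R$2$1 \<noteq> 0" using u_neq_0[OF fr'] by auto
  ultimately show thesis using that by blast
qed

text \<open>The Gram determinants agree up to a square, so the two exponents have the same parity
  and, both being 0 or 1, coincide. Rescaling one basis vector by a unit then matches the ratios of
  the norms.\<close>

lemma max_orders_isomorphic:
  assumes "max_dagger_order v J R" "max_dagger_order v J R'"
  shows "\<exists>\<phi>. auto_inv J \<phi> \<and> \<phi> ` R = R'"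
proof -
  obtain P Q u1 u2 where fr: "orth_frame b P Q u1 u2" and n: "v u2 - v u1 \<in> {0, 1}"
    and R: "R = conj_set P Q (eichler v (v u2 - v u1))" by (rule max_order_frame[OF assms(1)])
  obtain P' Q' w1 w2 where fr': "orth_frame b P' Q' w1 w2" and n': "v w2 - v w1 \<in> {0, 1}"
    and R': "R' = conj_set P' Q' (eichler v (v w2 - v w1))" by (rule max_order_frame[OF assms(2)])
  note nz = u_neq_0[OF fr] u_neq_0[OF fr']
  obtain d where d: "d \<noteq> 0" "w1 * w2 = u1 * u2 * d\<^sup>2" by (rule frame_gram_det[OF fr fr'])
  have "v (w1 * w2) = v (u1 * u2 * d\<^sup>2)" using d(2) by simp
  then have val: "v w1 + v w2 = v u1 + v u2 + 2 * v d"
    using nz d(1) by (simp add: v_mult v_square)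
  have eq: "v w2 - v w1 = v u2 - v u1" using val n n' unfolding insert_iff empty_iff by arith
  \<comment> \<open>With this choice \<open>w2 * t\<^sup>2 / w1\<close> becomes
    \<open>u2 / u1\<close> by the determinant relation; equality of the exponents gives
    \<open>v w1 = v u1 + v d\<close>, so \<open>t\<close> is a unit.\<close>
  define t where "t = w1 / (u1 * d)"
  have "v w1 = v u1 + v d" using val eq by simp
  then have t: "t \<noteq> 0" "v t = 0" using nz d(1) by (simp_all add: t_def v_divide v_mult)
  have "w2 * t\<^sup>2 / w1 = (w1 * w2) / (u1 * d)\<^sup>2"
    using nz by (simp add: t_def power2_eq_square mult_ac)
  also have "\<dots> = u2 / u1" unfolding d(2) using nz d(1) by (simp add: power2_eq_square)
  finally have ratio: "w2 * t\<^sup>2 / (w1 * 1\<^sup>2) = u2 / u1" by simp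
  have fr'': "orth_frame b (P' ** mat2 1 0 0 t) (mat2 (1 / 1) 0 0 (1 / t) ** Q') (w1 * 1\<^sup>2) (w2 * t\<^sup>2)"
    using t by (intro orth_frame_scale[OF fr']) auto
  note \<phi> = auto_inv_frames[OF fr fr'' ratio]
  have R'': "conj_set (P' ** mat2 1 0 0 t) (mat2 (1 / 1) 0 0 (1 / t) ** Q') (eichler v (v u2 - v u1)) = R'"
    unfolding R' eq using conj_set_eichler_scale[OF t] by simp
  show ?thesis
    by (intro exI conjI, rule \<phi>(1), unfold R, rule trans[OF \<phi>(2) R''])
qed

end

theorem theorem6p1:
  fixes v :: "'k::field \<Rightarrow> int"
    and J :: "'k quat \<Rightarrow> 'k quat"
    and b :: "'k vect \<Rightarrow> 'k vect \<Rightarrow> 'k"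
  assumes "nonarch_local_field v" and "nondyadic v"
    and "orth_involution J" and "adjoint_form J b"
  shows "(\<forall>Ord. max_dagger_order v J Ord \<longrightarrow>
            (\<exists>a L. frac_ideal v a \<and> a \<subseteq> oring v \<and> a_maximal v b a L \<and>
                   Ord = End_lat L \<inter> End_lat (dual_lattice v b L))) \<and>
         (\<forall>Ord1 Ord2. max_dagger_order v J Ord1 \<longrightarrow> max_dagger_order v J Ord2 \<longrightarrow>
            (\<exists>\<phi>. auto_inv J \<phi> \<and> \<phi> ` Ord1 = Ord2)) \<and>
         (\<forall>Ord. max_dagger_order v J Ord \<longrightarrow>
            reduced_disc v Ord = disc_H_split v \<inter> iota v (disc_inv_class J))"
proof -
  interpret adjoint_form_space v J b
    using assms by unfold_locales (simp_all add: nonarch_local_field_def)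
  show ?thesis
    by (intro conjI allI impI max_order_eq_End max_orders_isomorphic reduced_disc_max_order)
qed

end
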